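(* Let $u^{*,k}$ and $u_N^{*,k}$, $k=0,1,\dots,K$, be the optimal solutions (optimal controls; $k=0$: initial condition, $k\ge1$: model error) of the full-order combined 4D-Var problem (FE) and the reduced-order combined 4D-Var problem (RB), respectively, both defined in the context. The error satisfies $$\Big(\|u^{*,0}-u_N^{*,0}\|_U^2+\tau\sum_{k=1}^K\|u^{*,k}-u_N^{*,k}\|_U^2\Big)^{1/2}\;\le\;\hat\Delta_N^u(\mu):=c_1(\mu)+\sqrt{c_1(\mu)^2+c_2(\mu)}\qquad\forall\mu\in\mathcal{D},$$ where $c_1(\mu)$ and $c_2(\mu)$ are given by $$c_1(\mu)=\frac12\left(\Big(\|r_u^0(\cdot;\mu)\|_{U'}^2+\tilde R_u^2\Big)^{1/2}+\Big(\frac{2\gamma_b^2}{(\alpha_{\rm LB}(\mu))^2}+\frac{1}{\alpha_{\rm LB}(\mu)}\Big)^{1/2}\tilde R_p\right)$$ and $$c_2(\mu)=\frac{2\sqrt2}{\alpha_{\rm LB}(\mu)}\tilde R_y\tilde R_p+\frac{\gamma_c^2}{2(\alpha_{\rm LB}(\mu))^2}\tilde R_y^2 .$$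
   Context: Setting. $\Omega\subset\mathbb{R}^d$ is a bounded Lipschitz domain. $Y_{\rm e}$ is a Hilbert space with $H^1_0(\Omega)\subset Y_{\rm e}\subset H^1(\Omega)$, inner product $(\cdot,\cdot)_Y$ and induced norm $\|\cdot\|_Y$, assumed equivalent to the $H^1(\Omega)$-norm. $U_{\rm e}=L^2(\Omega)$ is the Hilbert space for the control, together with its inner product $(\cdot,\cdot)_U$ and induced norm $\|\cdot\|_U$. $Y\subset Y_{\rm e}$ and $U\subset U_{\rm e}$ are conforming finite element (finite-dimensional) subspaces with the inherited inner products and norms; $Y'$, $U'$ are the dual spaces, with dual norms $\|r\|_{Y'}=\sup_{v\in Y\setminus\{0\}}r(v)/\|v\|_Y$, and similarly for $U'$. $\mathcal{D}\subset\mathbb{R}^P$ is a compact parameter set. $T>0$ is a fixed final time, $K\in\mathbb{N}$, $\tau=T/K$, $\mathbb{K}=\{1,\dots,K\}$. The dependence of states, adjoints and controls on $\mu$ is not written explicitly. Forms. $m(w,v)=(w,v)_{L^2(\Omega)}$ for $w,v\in L^2(\Omega)$. $b(\cdot,\cdot):U\times Y\to\mathbb{R}$ is a continuous bilinear form with $\gamma_b=\sup_{w\in U\setminus\{0\}}\sup_{v\in Y\setminus\{0\}}\frac{b(w,v)}{\|w\|_U\|v\|_Y}<\infty$. For each $\mu\in\mathcal{D}$, $a(\cdot,\cdot;\mu):Y\times Y\to\mathbb{R}$ is a continuous bilinear form, coercive with $\alpha(\mu)=\inf_{v\in Y\setminus\{0\}}a(v,v;\mu)/\|v\|_Y^2\ge\underline{\alpha}>0$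 for all $\mu\in\mathcal{D}$, and affine in the parameter: $a(w,v;\mu)=\sum_{q=1}^{Q_a}\Theta_a^q(\mu)a^q(w,v)$ with continuous $\Theta_a^q:\mathcal{D}\to\mathbb{R}$ and continuous parameter-independent bilinear forms $a^q$. $f:Y\to\mathbb{R}$ is a continuous linear functional. $D=\mathbb{R}^\ell$ is the observation space with inner product $(\cdot,\cdot)_D$ and norm $\|\cdot\|_D$; $C:Y\to D$ is the continuous linear operator $C\phi=(h_1(\phi),\dots,h_\ell(\phi))^T$ with $h_i\in Y'$, and $\gamma_c=\sup_{v\in Y\setminus\{0\}}\|Cv\|_D/\|v\|_Y$. A positive lower bound $\alpha_{\rm LB}:\mathcal{D}\to\mathbb{R}_+$ is given with $0<\underline{\alpha}\le\alpha_{\rm LB}(\mu)\le\alpha(\mu)$ for all $\mu\in\mathcal{D}$. Data: $u_d^k\in U$ for $k=0,\dots,K$ ($u_d^0$ is the background state) and observations $z_d^k\in D$ for $k\in\mathbb{K}$. Full-order problem (FE). For given $\mu\in\mathcal{D}$, minimize $J(y,u;\mu)=\frac12\|u^0-u_d^0\|_U^2+\frac\tau2\sum_{k=1}^K\|u^k-u_d^k\|_U^2+\frac\tau2\sum_{k=1}^K\|Cy^k-z_d^k\|_D^2$ over $y\in Y^K$, $u=(u^0,\dots,u^K)\in U^{K+1}$, subject to $m(y^k,v)+\tau a(y^k,v;\mu)=m(y^{k-1},v)+\tau b(u^k,v)+\tau f(v)$ for all $v\in Y$, $k\in\mathbb{K}$, with initial condition $m(y^0,v)=m(u^0,v)$ for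 all $v\in Y$. The necessary and sufficient first-order optimality conditions are: $(y^*,p^*,u^* )\in Y^K\times Y^K\times U^{K+1}$ satisfies - $m(y^{*,k}-y^{*,k-1},\phi)+\tau a(y^{*,k},\phi;\mu)=\tau b(u^{*,k},\phi)+\tau f(\phi)$ for all $\phi\in Y$, $k\in\mathbb{K}$, and $m(y^{*,0},\phi)=m(u^{*,0},\phi)$ for all $\phi\in Y$; - $m(\varphi,p^{*,k}-p^{*,k+1})+\tau a(\varphi,p^{*,k};\mu)=\tau(z_d^k-Cy^{*,k},C\varphi)_D$ for all $\varphi\in Y$, $k\in\mathbb{K}$, with $p^{*,K+1}=0$; - $\tau(u^{*,k}-u_d^k,\psi)_U-\tau b(\psi,p^{*,k})=0$ for all $\psi\in U$, $k\in\mathbb{K}$; - $(u^{*,0}-u_d^0,\psi)_U-m(\psi,p^{*,1})=0$ for all $\psi\in U$. Reduced-order problem (RB). $Y_N\subset Y$ (for state and adjoint), $U_N^0\subset U$ (for the initial condition) and $U_N\subset U$ (for the model error) are given linear subspaces (reduced basis spaces). For given $\mu\in\mathcal{D}$, minimize $J(y_N,u_N;\mu)$ over $y_N\in Y_N^K$, $u_N=(u_N^0,\dots,u_N^K)\in U_N^0\times U_N^K$ subject to $m(y_N^k,v)+\tau a(y_N^k,v;\mu)=m(y_N^{k-1},v)+\tau b(u_N^k,v)+\tau f(v)$ for all $v\in Y_N$, $k\in\mathbb{K}$, with initial condition $m(y_N^0,v)=m(u_N^0,v)$ for all $v\in Y_N$. The optimal solution $(y_N^*,p_N^*,u_N^*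 )\in Y_N^K\times Y_N^K\times(U_N^0\times U_N^K)$ satisfies the reduced-order optimality system, obtained from the full-order one by restriction to the reduced basis spaces: - $m(y_N^{*,k}-y_N^{*,k-1},\phi)+\tau a(y_N^{*,k},\phi;\mu)=\tau b(u_N^{*,k},\phi)+\tau f(\phi)$ for all $\phi\in Y_N$, $k\in\mathbb{K}$, and $m(y_N^{*,0},\phi)=m(u_N^{*,0},\phi)$ for all $\phi\in Y_N$; - $m(\varphi,p_N^{*,k}-p_N^{*,k+1})+\tau a(\varphi,p_N^{*,k};\mu)=\tau(z_d^k-Cy_N^{*,k},C\varphi)_D$ for all $\varphi\in Y_N$, $k\in\mathbb{K}$, with $p_N^{*,K+1}=0$; - $\tau(u_N^{*,k}-u_d^k,\psi)_U-\tau b(\psi,p_N^{*,k})=0$ for all $\psi\in U_N$, $k\in\mathbb{K}$; - $(u_N^{*,0}-u_d^0,\psi)_U-m(\psi,p_N^{*,1})=0$ for all $\psi\in U_N^0$. Residuals. For $k\in\mathbb{K}$, $\phi,\varphi\in Y$, $\psi\in U$: $\tilde r_y^k(\phi;\mu)=f(\phi)+b(u_N^{*,k},\phi)-a(y_N^{*,k},\phi;\mu)-\frac1\tau m(y_N^{*,k}-y_N^{*,k-1},\phi)$, $\tilde r_p^k(\varphi;\mu)=(z_d^k-Cy_N^{*,k},C\varphi)_D-a(\varphi,p_N^{*,k};\mu)-\frac1\tau m(\varphi,p_N^{*,k}-p_N^{*,k+1})$, $\tilde r_u^k(\psi;\mu)=b(\psi,p_N^{*,k})-(u_N^{*,k}-u_d^k,\psi)_U$,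 $r_u^0(\psi;\mu)=m(\psi,p_N^{*,1})-(u_N^{*,0}-u_d^0,\psi)_U$. Set $\tilde R_y=\big(\tau\sum_{k=1}^K\|\tilde r_y^k(\cdot;\mu)\|_{Y'}^2\big)^{1/2}$, $\tilde R_p=\big(\tau\sum_{k=1}^K\|\tilde r_p^k(\cdot;\mu)\|_{Y'}^2\big)^{1/2}$, $\tilde R_u=\big(\tau\sum_{k=1}^K\|\tilde r_u^k(\cdot;\mu)\|_{U'}^2\big)^{1/2}$.
   Formalization: Added assumption: m(y_N^{*,0},φ)=m(u_N^{*,0},φ) for all φ in Y, not only in Y_N (true if y_N^{*,0}=u_N^{*,0}, or y_N^{*,0} in Y_N and U_N^0 ⊂ Y_N); without it the bound, having no initial-condition residual, can be 0 with nonzero error. (·,·)_U is read as the L²(Ω) inner product. *)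

theory Defs
  imports "HOL-Analysis.Analysis"
begin

section \<open>Square-integrable functions modulo null sets\<close>

definition square_integrable :: "(real^'d \<Rightarrow> real) \<Rightarrow> bool" where
  "square_integrable f \<longleftrightarrow>
     f \<in> borel_measurable lebesgue \<and> integrable lebesgue (\<lambda>x. (f x)\<^sup>2)"

lemma square_integrable_mult:
  assumes "square_integrable f" "square_integrable g"
  shows "integrable lebesgue (\<lambda>x. f x * g x)"
proof (rule Bochner_Integration.integrable_bound)
  show "integrable lebesgue (\<lambda>x. (f x)\<^sup>2 + (g x)\<^sup>2)"
    using assms by (simp add: square_integrable_def)
  show "(\<lambda>x. f x * g x) \<in> borel_measurable lebesgue"
    using assms by (auto simp: square_integrable_def)
  have "\<bar>a * b\<bar> \<le> a\<^sup>2 + b\<^sup>2" for a b :: real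
    using sum_squares_bound[of "\<bar>a\<bar>" "\<bar>b\<bar>"] mult_nonneg_nonneg[of "\<bar>a\<bar>" "\<bar>b\<bar>"]
    unfolding abs_mult power2_abs by linarith
  then show "AE x in lebesgue. norm (f x * g x) \<le> norm ((f x)\<^sup>2 + (g x)\<^sup>2)"
    by simp
qed

lemma square_integrable_0: "square_integrable (\<lambda>x. 0)"
  by (simp add: square_integrable_def)

lemma square_integrable_scale:
  "square_integrable f \<Longrightarrow> square_integrable (\<lambda>x. c * f x)"
  by (auto simp: square_integrable_def power_mult_distrib)

lemma square_integrable_add:
  assumes "square_integrable f" "square_integrable g"
  shows "square_integrable (\<lambda>x. f x + g x)"
  using assms square_integrable_mult[OF assms]
  by (auto simp: square_integrable_def power2_sum mult.assoc)

quotient_type 'd l2 = "real^'d \<Rightarrow> real" / partial: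
  "\<lambda>f g. square_integrable f \<and> square_integrable g \<and> (AE x in lebesgue. f x = g x)"
proof (rule part_equivpI)
  show "\<exists>f::real^'d \<Rightarrow> real.
      square_integrable f \<and> square_integrable f \<and> (AE x in lebesgue. f x = f x)"
    using square_integrable_0 by auto
qed (auto intro!: sympI transpI elim: AE_mp)

instantiation l2 :: (finite) real_vector
begin

lift_definition zero_l2 :: "'a l2" is "\<lambda>x. 0"
  by (simp add: square_integrable_0)

lift_definition plus_l2 :: "'a l2 \<Rightarrow> 'a l2 \<Rightarrow> 'a l2" is "\<lambda>f g x. f x + g x"
  by (auto intro: square_integrable_add)

lift_definition scaleR_l2 :: "real \<Rightarrow> 'a l2 \<Rightarrow> 'a l2" is "\<lambda>c f x. c * f x"
  by (auto intro: square_integrable_scale)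

lift_definition uminus_l2 :: "'a l2 \<Rightarrow> 'a l2" is "\<lambda>f x. - f x"
  using square_integrable_scale[of _ "-1"] by auto

definition minus_l2 :: "'a l2 \<Rightarrow> 'a l2 \<Rightarrow> 'a l2" where "minus_l2 u v = u + - v"

instance
proof
  fix u v w :: "'a l2" and r s :: real
  show "u + v + w = u + (v + w)"
    by transfer (auto intro!: square_integrable_add simp: add.assoc)
  show "u + v = v + u"
    by transfer (auto intro!: square_integrable_add simp: add.commute)
  show "0 + u = u" by transfer auto
  show "- u + u = 0"
    by transfer (auto simp: square_integrable_0)
  show "u - v = u + - v" by (rule minus_l2_def)
  show "r *\<^sub>R (u + v) = r *\<^sub>R u + r *\<^sub>R v"
    by transfer (auto intro!: square_integrable_add square_integrable_scale simp: algebra_simps)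
  show "(r + s) *\<^sub>R u = r *\<^sub>R u + s *\<^sub>R u"
    by transfer (auto intro!: square_integrable_add square_integrable_scale simp: algebra_simps)
  show "r *\<^sub>R s *\<^sub>R u = (r * s) *\<^sub>R u"
    by transfer (auto intro!: square_integrable_scale simp: algebra_simps)
  show "1 *\<^sub>R u = u" by transfer auto
qed

end

instantiation l2 :: (finite) real_inner
begin

lift_definition inner_l2 :: "'a l2 \<Rightarrow> 'a l2 \<Rightarrow> real" is
  "\<lambda>f g. LINT x|lebesgue. f x * g x"
proof -
  fix f f' g g' :: "real^'a \<Rightarrow> real"
  assume f: "square_integrable f \<and> square_integrable f' \<and> (AE x in lebesgue. f x = f' x)"
    and g: "square_integrable g \<and> square_integrable g' \<and> (AE x in lebesgue. g x = g' x)"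
  have "AE x in lebesgue. f x * g x = f' x * g' x" using f g by auto
  then show "(LINT x|lebesgue. f x * g x) = (LINT x|lebesgue. f' x * g' x)"
    using f g by (intro integral_cong_AE) (auto simp: square_integrable_def)
qed

definition norm_l2 :: "'a l2 \<Rightarrow> real" where "norm_l2 u = sqrt (inner u u)"
definition sgn_l2 :: "'a l2 \<Rightarrow> 'a l2" where "sgn_l2 u = u /\<^sub>R norm u"
definition dist_l2 :: "'a l2 \<Rightarrow> 'a l2 \<Rightarrow> real" where "dist_l2 u v = norm (u - v)"
definition uniformity_l2 :: "('a l2 \<times> 'a l2) filter" where
  "uniformity_l2 = (INF e\<in>{0<..}. principal {(x, y). dist x y < e})"
definition open_l2 :: "'a l2 set \<Rightarrow> bool" where
  "open_l2 S = (\<forall>x\<in>S. \<forall>\<^sub>F (x', y) in uniformity. x' = x \<longrightarrow> y \<in> S)"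

instance
proof
  fix u v w :: "'a l2" and r :: real
  show "sgn u = u /\<^sub>R norm u" by (rule sgn_l2_def)
  show "dist u v = norm (u - v)" by (rule dist_l2_def)
  show "inner u v = inner v u" by transfer (simp add: mult.commute)
  show "inner (u + v) w = inner u w + inner v w"
    by transfer (simp add: algebra_simps square_integrable_mult)
  show "inner (r *\<^sub>R u) v = r * inner u v"
    by transfer (simp add: mult.assoc)
  show "0 \<le> inner u u" by transfer simp
  show "inner u u = 0 \<longleftrightarrow> u = 0"
  proof transfer
    fix f :: "real^'a \<Rightarrow> real"
    assume f: "square_integrable f \<and> square_integrable f \<and> (AE x in lebesgue. f x = f x)"
    have "(LINT x|lebesgue. f x * f x) = 0 \<longleftrightarrow> (AE x in lebesgue. f x * f x = 0)"
      using f by (intro integral_nonneg_eq_0_iff_AE) (auto intro: square_integrable_mult)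
    then show "(LINT x|lebesgue. f x * f x) = 0 \<longleftrightarrow>
        square_integrable f \<and> square_integrable (\<lambda>x. 0) \<and> (AE x in lebesgue. f x = 0)"
      using f by (auto simp: square_integrable_0)
  qed
  show "norm u = sqrt (inner u u)" by (rule norm_l2_def)
qed (simp_all add: uniformity_l2_def open_l2_def)

end

text \<open>
  \<open>L\<^sup>2(\<Omega>)\<close> is identified isometrically with the classes on the whole space that vanish
  almost everywhere outside \<open>\<Omega>\<close>; its inner product is then \<^const>\<open>inner\<close>.
\<close>

lift_definition vanishes_off :: "(real^'d) set \<Rightarrow> 'd l2 \<Rightarrow> bool" is
  "\<lambda>\<Omega> f. AE x in lebesgue. x \<notin> \<Omega> \<longrightarrow> f x = 0"
  by (auto elim: AE_mp)

definition l2_on :: "(real^'d) set \<Rightarrow> 'd l2 set" where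
  "l2_on \<Omega> = {u. vanishes_off \<Omega> u}"


section \<open>Lipschitz domains and first-order Sobolev spaces\<close>

text \<open>
  Near each boundary point, after choosing a direction \<open>e\<close>, the domain lies strictly above the
  graph of a Lipschitz function of the component orthogonal to \<open>e\<close>.
\<close>

definition bounded_lipschitz_domain :: "(real^'d) set \<Rightarrow> bool" where
  "bounded_lipschitz_domain \<Omega> \<longleftrightarrow>
     open \<Omega> \<and> connected \<Omega> \<and> \<Omega> \<noteq> {} \<and> bounded \<Omega> \<and>
     (\<forall>x0\<in>frontier \<Omega>. \<exists>r>0. \<exists>e L. \<exists>g :: real^'d \<Rightarrow> real.
        norm e = 1 \<and> L-lipschitz_on UNIV g \<and>
        \<Omega> \<inter> ball x0 r = {x \<in> ball x0 r. g (x - (x \<bullet> e) *\<^sub>R e) < x \<bullet> e})"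

definition partial_deriv :: "'d \<Rightarrow> (real^'d \<Rightarrow> real) \<Rightarrow> real^'d \<Rightarrow> real" where
  "partial_deriv i \<phi> x = frechet_derivative \<phi> (at x) (axis i 1)"

primrec cont_diff :: "nat \<Rightarrow> (real^'d \<Rightarrow> real) \<Rightarrow> bool" where
  "cont_diff 0 \<phi> \<longleftrightarrow> continuous_on UNIV \<phi>"
| "cont_diff (Suc n) \<phi> \<longleftrightarrow>
     (\<forall>x. \<phi> differentiable (at x)) \<and> (\<forall>i. cont_diff n (partial_deriv i \<phi>))"

definition test_functions :: "(real^'d) set \<Rightarrow> (real^'d \<Rightarrow> real) set" where
  "test_functions \<Omega> =
     {\<phi>. (\<forall>n. cont_diff n \<phi>) \<and> (\<exists>S. compact S \<and> S \<subseteq> \<Omega> \<and> (\<forall>x. x \<notin> S \<longrightarrow> \<phi> x = 0))}"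

definition is_weak_deriv :: "(real^'d) set \<Rightarrow> 'd \<Rightarrow> 'd l2 \<Rightarrow> 'd l2 \<Rightarrow> bool" where
  "is_weak_deriv \<Omega> i u g \<longleftrightarrow> g \<in> l2_on \<Omega> \<and>
     (\<forall>\<phi>\<in>test_functions \<Omega>. u \<bullet> abs_l2 (partial_deriv i \<phi>) = - (g \<bullet> abs_l2 \<phi>))"

definition weak_deriv :: "(real^'d) set \<Rightarrow> 'd \<Rightarrow> 'd l2 \<Rightarrow> 'd l2" where
  "weak_deriv \<Omega> i u = (THE g. is_weak_deriv \<Omega> i u g)"

definition H1 :: "(real^'d) set \<Rightarrow> 'd l2 set" where
  "H1 \<Omega> = {u \<in> l2_on \<Omega>. \<forall>i. \<exists>g. is_weak_deriv \<Omega> i u g}"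

definition H1_norm :: "(real^'d) set \<Rightarrow> 'd l2 \<Rightarrow> real" where
  "H1_norm \<Omega> u = sqrt ((norm u)\<^sup>2 + (\<Sum>i\<in>UNIV. (norm (weak_deriv \<Omega> i u))\<^sup>2))"

definition H1_0 :: "(real^'d) set \<Rightarrow> 'd l2 set" where
  "H1_0 \<Omega> = {u \<in> H1 \<Omega>. \<exists>\<phi>. (\<forall>n. \<phi> n \<in> test_functions \<Omega>) \<and>
     (\<lambda>n. H1_norm \<Omega> (u - abs_l2 (\<phi> n))) \<longlonglongrightarrow> 0}"


section \<open>Functionals, forms and norms on subspaces\<close>

definition linear_on :: "'a::real_vector set \<Rightarrow> ('a \<Rightarrow> real) \<Rightarrow> bool" where
  "linear_on V r \<longleftrightarrow>
     (\<forall>x\<in>V. \<forall>y\<in>V. r (x + y) = r x + r y) \<and> (\<forall>x\<in>V. \<forall>c. r (c *\<^sub>R x) = c * r x)"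

definition bilinear_on ::
  "'a::real_vector set \<Rightarrow> 'b::real_vector set \<Rightarrow> ('a \<Rightarrow> 'b \<Rightarrow> real) \<Rightarrow> bool" where
  "bilinear_on V W b \<longleftrightarrow>
     (\<forall>w\<in>W. linear_on V (\<lambda>v. b v w)) \<and> (\<forall>v\<in>V. linear_on W (b v))"

definition inner_product_on :: "'a::real_vector set \<Rightarrow> ('a \<Rightarrow> 'a \<Rightarrow> real) \<Rightarrow> bool" where
  "inner_product_on V ip \<longleftrightarrow> bilinear_on V V ip \<and>
     (\<forall>x\<in>V. \<forall>y\<in>V. ip x y = ip y x) \<and> (\<forall>x\<in>V - {0}. 0 < ip x x)"

definition ip_norm :: "('a \<Rightarrow> 'a \<Rightarrow> real) \<Rightarrow> 'a \<Rightarrow> real" where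
  "ip_norm ip x = sqrt (ip x x)"

definition hilbert_space_on :: "'a::real_vector set \<Rightarrow> ('a \<Rightarrow> 'a \<Rightarrow> real) \<Rightarrow> bool" where
  "hilbert_space_on V ip \<longleftrightarrow> subspace V \<and> inner_product_on V ip \<and>
     (\<forall>X. (\<forall>n::nat. X n \<in> V) \<and>
          (\<forall>\<epsilon>>0. \<exists>N. \<forall>m\<ge>N. \<forall>n\<ge>N. ip_norm ip (X m - X n) < \<epsilon>) \<longrightarrow>
          (\<exists>x\<in>V. (\<lambda>n. ip_norm ip (X n - x)) \<longlonglongrightarrow> 0))"

definition finite_dim_subspace :: "'a::real_vector set \<Rightarrow> bool" where
  "finite_dim_subspace V \<longleftrightarrow> subspace V \<and> (\<exists>B. finite B \<and> V = span B)"

definition continuous_functional ::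
  "'a::real_vector set \<Rightarrow> ('a \<Rightarrow> real) \<Rightarrow> ('a \<Rightarrow> real) \<Rightarrow> bool" where
  "continuous_functional V nV r \<longleftrightarrow>
     linear_on V r \<and> (\<exists>M. \<forall>v\<in>V. \<bar>r v\<bar> \<le> M * nV v)"

definition continuous_form ::
  "'a::real_vector set \<Rightarrow> ('a \<Rightarrow> real) \<Rightarrow> 'b::real_vector set \<Rightarrow> ('b \<Rightarrow> real) \<Rightarrow>
   ('a \<Rightarrow> 'b \<Rightarrow> real) \<Rightarrow> bool" where
  "continuous_form V nV W nW b \<longleftrightarrow>
     bilinear_on V W b \<and> (\<exists>M. \<forall>v\<in>V. \<forall>w\<in>W. \<bar>b v w\<bar> \<le> M * nV v * nW w)"

text \<open>
  In the following suprema, inserting \<open>0\<close> changes nothing unless the supremum is over the empty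
  set, where it gives the value \<open>0\<close>.
\<close>

definition dual_norm ::
  "'a::real_vector set \<Rightarrow> ('a \<Rightarrow> real) \<Rightarrow> ('a \<Rightarrow> real) \<Rightarrow> real" where
  "dual_norm V nV r = Sup (insert 0 {r v / nV v |v. v \<in> V - {0}})"

definition form_norm ::
  "'a::real_vector set \<Rightarrow> ('a \<Rightarrow> real) \<Rightarrow> 'b::real_vector set \<Rightarrow> ('b \<Rightarrow> real) \<Rightarrow>
   ('a \<Rightarrow> 'b \<Rightarrow> real) \<Rightarrow> real" where
  "form_norm V nV W nW b =
     Sup (insert 0 {b v w / (nV v * nW w) |v w. v \<in> V - {0} \<and> w \<in> W - {0}})"

definition operator_norm ::
  "'a::real_vector set \<Rightarrow> ('a \<Rightarrow> real) \<Rightarrow> ('b \<Rightarrow> real) \<Rightarrow> ('a \<Rightarrow> 'b) \<Rightarrow> real" where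
  "operator_norm V nV nW C = Sup (insert 0 {nW (C v) / nV v |v. v \<in> V - {0}})"

definition coercivity_const ::
  "'a::real_vector set \<Rightarrow> ('a \<Rightarrow> real) \<Rightarrow> ('a \<Rightarrow> 'a \<Rightarrow> real) \<Rightarrow> ereal" where
  "coercivity_const V nV a = (INF v\<in>V - {0}. ereal (a v v / (nV v)\<^sup>2))"


section \<open>The discrete 4D-Var problem\<close>

text \<open>
  Trajectories are functions of the time index, of which only the indices \<open>0..K\<close> (states and
  controls) or \<open>1..K+1\<close> (adjoints) matter. The control space has its \<open>L\<^sup>2\<close> inner product, so
  \<open>\<parallel>\<cdot>\<parallel>\<^sub>U\<close> is \<^const>\<open>norm\<close>, and \<open>m\<close> and \<open>(\<cdot>,\<cdot>)\<^sub>U\<close> are both \<^const>\<open>inner\<close>.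
\<close>

definition cost ::
  "real \<Rightarrow> nat \<Rightarrow> ('v::real_inner \<Rightarrow> 'z::real_vector) \<Rightarrow> ('z \<Rightarrow> 'z \<Rightarrow> real) \<Rightarrow>
   (nat \<Rightarrow> 'v) \<Rightarrow> (nat \<Rightarrow> 'z) \<Rightarrow> (nat \<Rightarrow> 'v) \<times> (nat \<Rightarrow> 'v) \<Rightarrow> real" where
  "cost \<tau> K C ipD u_d z_d = (\<lambda>(y, u).
     (norm (u 0 - u_d 0))\<^sup>2 / 2
     + \<tau> / 2 * (\<Sum>k=1..K. (norm (u k - u_d k))\<^sup>2)
     + \<tau> / 2 * (\<Sum>k=1..K. (ip_norm ipD (C (y k) - z_d k))\<^sup>2))"

text \<open>
  \<open>V\<close> is the trial and test space of the state, \<open>W0\<close> the space of the initial control and \<open>W\<close>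
  that of the later ones. The initial state \<open>y 0\<close> ranges over the ambient space \<open>H\<close>: it enters
  only through its inner products with test functions and is not one of the unknowns
  \<open>y 1, \<dots>, y K\<close>. Different choices with the same inner products against \<open>V\<close> give the same
  problem, but they change the functional \<open>res_y\<close> at \<open>k = 1\<close> on spaces larger than \<open>V\<close>.
\<close>

definition feasible ::
  "real \<Rightarrow> nat \<Rightarrow> ('v::real_inner \<Rightarrow> 'v \<Rightarrow> real) \<Rightarrow> ('v \<Rightarrow> 'v \<Rightarrow> real) \<Rightarrow> ('v \<Rightarrow> real) \<Rightarrow>
   'v set \<Rightarrow> 'v set \<Rightarrow> 'v set \<Rightarrow> 'v set \<Rightarrow> (nat \<Rightarrow> 'v) \<times> (nat \<Rightarrow> 'v) \<Rightarrow> bool" where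
  "feasible \<tau> K a b f H V W0 W = (\<lambda>(y, u).
     y 0 \<in> H \<and> (\<forall>k\<in>{1..K}. y k \<in> V) \<and> u 0 \<in> W0 \<and> (\<forall>k\<in>{1..K}. u k \<in> W) \<and>
     (\<forall>v\<in>V. y 0 \<bullet> v = u 0 \<bullet> v) \<and>
     (\<forall>k\<in>{1..K}. \<forall>v\<in>V.
        y k \<bullet> v + \<tau> * a (y k) v = y (k - 1) \<bullet> v + \<tau> * b (u k) v + \<tau> * f v))"

definition adjoint_solution ::
  "real \<Rightarrow> nat \<Rightarrow> ('v::real_inner \<Rightarrow> 'v \<Rightarrow> real) \<Rightarrow> ('v \<Rightarrow> 'z::real_vector) \<Rightarrow>
   ('z \<Rightarrow> 'z \<Rightarrow> real) \<Rightarrow> (nat \<Rightarrow> 'z) \<Rightarrow> 'v set \<Rightarrow> (nat \<Rightarrow> 'v) \<Rightarrow> (nat \<Rightarrow> 'v) \<Rightarrow> bool" where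
  "adjoint_solution \<tau> K a C ipD z_d V y p \<longleftrightarrow>
     (\<forall>k\<in>{1..K}. p k \<in> V) \<and> p (K + 1) = 0 \<and>
     (\<forall>k\<in>{1..K}. \<forall>\<phi>\<in>V.
        \<phi> \<bullet> (p k - p (k + 1)) + \<tau> * a \<phi> (p k) = \<tau> * ipD (z_d k - C (y k)) (C \<phi>))"

definition res_y ::
  "real \<Rightarrow> ('v::real_inner \<Rightarrow> 'v \<Rightarrow> real) \<Rightarrow> ('v \<Rightarrow> 'v \<Rightarrow> real) \<Rightarrow> ('v \<Rightarrow> real) \<Rightarrow>
   (nat \<Rightarrow> 'v) \<Rightarrow> (nat \<Rightarrow> 'v) \<Rightarrow> nat \<Rightarrow> 'v \<Rightarrow> real" where
  "res_y \<tau> a b f y u k \<phi> =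
     f \<phi> + b (u k) \<phi> - a (y k) \<phi> - 1 / \<tau> * ((y k - y (k - 1)) \<bullet> \<phi>)"

definition res_p ::
  "real \<Rightarrow> ('v::real_inner \<Rightarrow> 'v \<Rightarrow> real) \<Rightarrow> ('v \<Rightarrow> 'z::real_vector) \<Rightarrow> ('z \<Rightarrow> 'z \<Rightarrow> real) \<Rightarrow>
   (nat \<Rightarrow> 'z) \<Rightarrow> (nat \<Rightarrow> 'v) \<Rightarrow> (nat \<Rightarrow> 'v) \<Rightarrow> nat \<Rightarrow> 'v \<Rightarrow> real" where
  "res_p \<tau> a C ipD z_d y p k \<phi> =
     ipD (z_d k - C (y k)) (C \<phi>) - a \<phi> (p k) - 1 / \<tau> * (\<phi> \<bullet> (p k - p (k + 1)))"

definition res_u ::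
  "('v::real_inner \<Rightarrow> 'v \<Rightarrow> real) \<Rightarrow> (nat \<Rightarrow> 'v) \<Rightarrow> (nat \<Rightarrow> 'v) \<Rightarrow> (nat \<Rightarrow> 'v) \<Rightarrow>
   nat \<Rightarrow> 'v \<Rightarrow> real" where
  "res_u b u_d p u k \<psi> = b \<psi> (p k) - (u k - u_d k) \<bullet> \<psi>"

definition res_u0 ::
  "(nat \<Rightarrow> 'v::real_inner) \<Rightarrow> (nat \<Rightarrow> 'v) \<Rightarrow> (nat \<Rightarrow> 'v) \<Rightarrow> 'v \<Rightarrow> real" where
  "res_u0 u_d p u \<psi> = \<psi> \<bullet> p 1 - (u 0 - u_d 0) \<bullet> \<psi>"

definition time_dual_norm ::
  "real \<Rightarrow> nat \<Rightarrow> 'v::real_vector set \<Rightarrow> ('v \<Rightarrow> real) \<Rightarrow> (nat \<Rightarrow> 'v \<Rightarrow> real) \<Rightarrow> real" where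
  "time_dual_norm \<tau> K V nV r = sqrt (\<tau> * (\<Sum>k=1..K. (dual_norm V nV (r k))\<^sup>2))"

end

theory Submission
  imports Defs
begin

text \<open>
  Let \<open>e = u - u_N\<close>, let \<open>s\<close> solve the homogeneous full-order state equation with control \<open>e\<close>, and
  let \<open>d = y - y_N - s\<close>, which solves the state equation with the state residuals as right-hand
  side. Stationarity of the full-order cost in the feasible direction \<open>(s, e)\<close>, combined with the
  definition of the residuals and summation by parts, expresses the squared control error as the
  control residuals applied to \<open>e\<close>, plus the adjoint residuals applied to \<open>s\<close>, minus
  \<open>\<tau> \<Sum>\<^sub>k (C (s\<^sub>k + d\<^sub>k), C s\<^sub>k)\<^sub>D \<le> \<tau>/4 \<Sum>\<^sub>k \<parallel>C d\<^sub>k\<parallel>\<^sup>2\<close>. Energy estimates bound \<open>s\<close> by the control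
  error and \<open>d\<close> by \<open>Ry\<close>, which leaves a quadratic inequality for the control error. The
  full-order adjoint is never needed.
\<close>

section \<open>Functionals and forms on subspaces\<close>

lemma linear_on_add: "linear_on V r \<Longrightarrow> x \<in> V \<Longrightarrow> y \<in> V \<Longrightarrow> r (x + y) = r x + r y"
  and linear_on_scale: "linear_on V r \<Longrightarrow> x \<in> V \<Longrightarrow> r (c *\<^sub>R x) = c * r x"
  by (auto simp: linear_on_def)

lemma linear_on_diff:
  assumes "linear_on V r" "subspace V" "x \<in> V" "y \<in> V"
  shows "r (x - y) = r x - r y"
  using linear_on_add[OF assms(1,3), of "- 1 *\<^sub>R y"] linear_on_scale[OF assms(1,4), of "-1"]
    subspace_scale[OF assms(2,4), of "-1"] by simp

lemma linear_on_subset: "linear_on V r \<Longrightarrow> W \<subseteq> V \<Longrightarrow> linear_on W r"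
  by (simp add: linear_on_def subset_eq)

lemma linear_on_0: "linear_on V r \<Longrightarrow> 0 \<in> V \<Longrightarrow> r 0 = 0"
  using linear_on_scale[of V r 0 0] by simp

lemma bilinear_on_left: "bilinear_on V W b \<Longrightarrow> w \<in> W \<Longrightarrow> linear_on V (\<lambda>v. b v w)"
  and bilinear_on_right: "bilinear_on V W b \<Longrightarrow> v \<in> V \<Longrightarrow> linear_on W (b v)"
  by (auto simp: bilinear_on_def)

lemma inner_product_on_nonneg:
  assumes "inner_product_on V ip" "x \<in> V"
  shows "0 \<le> ip x x"
  using assms linear_on_0[OF bilinear_on_right, of V V ip x]
  by (cases "x = 0") (auto simp: inner_product_on_def less_imp_le)

lemma inner_product_on_subset:
  "inner_product_on V ip \<Longrightarrow> W \<subseteq> V \<Longrightarrow> inner_product_on W ip"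
  by (auto simp: inner_product_on_def bilinear_on_def linear_on_def subset_eq)

lemma ip_norm_square: "inner_product_on V ip \<Longrightarrow> x \<in> V \<Longrightarrow> (ip_norm ip x)\<^sup>2 = ip x x"
  by (simp add: ip_norm_def inner_product_on_nonneg)

lemma ip_norm_pos: "inner_product_on V ip \<Longrightarrow> x \<in> V \<Longrightarrow> x \<noteq> 0 \<Longrightarrow> 0 < ip_norm ip x"
  by (auto simp: ip_norm_def inner_product_on_def)

lemma ip_norm_0:
  assumes "inner_product_on V ip" "0 \<in> V"
  shows "ip_norm ip 0 = 0"
  using linear_on_0[OF bilinear_on_right, of V V ip 0] assms
  by (simp add: ip_norm_def inner_product_on_def)

text \<open>The closure lemmas from here on assemble the continuity of each residual from its
  summands. Continuity keeps the \<open>Sup\<close> in \<open>dual_norm\<close> over a bounded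
  set.\<close>

lemma continuous_functional_add:
  assumes "continuous_functional V n r" "continuous_functional V n s"
  shows "continuous_functional V n (\<lambda>v. r v + s v)"
proof -
  obtain M N where "\<forall>v\<in>V. \<bar>r v\<bar> \<le> M * n v" "\<forall>v\<in>V. \<bar>s v\<bar> \<le> N * n v"
    using assms by (auto simp: continuous_functional_def)
  then have "\<forall>v\<in>V. \<bar>r v + s v\<bar> \<le> (M + N) * n v"
    by (force simp: algebra_simps)
  moreover have "linear_on V (\<lambda>v. r v + s v)"
    using assms by (auto simp: continuous_functional_def linear_on_def algebra_simps)
  ultimately show ?thesis
    unfolding continuous_functional_def by blast
qed

lemma continuous_functional_cmult:
  assumes "continuous_functional V n r"
  shows "continuous_functional V n (\<lambda>v. c * r v)"
proof -
  obtain M where "\<forall>v\<in>V. \<bar>r v\<bar> \<le> M * n v"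
    using assms by (auto simp: continuous_functional_def)
  then have "\<forall>v\<in>V. \<bar>c * r v\<bar> \<le> (\<bar>c\<bar> * M) * n v"
    by (simp add: abs_mult mult_left_mono mult.assoc)
  moreover have "linear_on V (\<lambda>v. c * r v)"
    using assms by (auto simp: continuous_functional_def linear_on_def algebra_simps)
  ultimately show ?thesis
    unfolding continuous_functional_def by blast
qed

lemma continuous_functional_diff:
  assumes "continuous_functional V n r" "continuous_functional V n s"
  shows "continuous_functional V n (\<lambda>v. r v - s v)"
  using continuous_functional_add[OF assms(1) continuous_functional_cmult[OF assms(2), of "-1"]]
  by simp

lemma continuous_form_left:
  assumes "continuous_form V n W n' b" "w \<in> W"
  shows "continuous_functional V n (\<lambda>v. b v w)"
proof -
  obtain M where "\<forall>v\<in>V. \<forall>w\<in>W. \<bar>b v w\<bar> \<le> M * n v * n' w"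
    using assms by (auto simp: continuous_form_def)
  then have "\<forall>v\<in>V. \<bar>b v w\<bar> \<le> (M * n' w) * n v"
    using assms(2) by (simp add: ac_simps)
  with assms show ?thesis
    unfolding continuous_functional_def continuous_form_def by (blast intro: bilinear_on_left)
qed

lemma continuous_form_right:
  assumes "continuous_form V n W n' b" "v \<in> V"
  shows "continuous_functional W n' (b v)"
  using assms unfolding continuous_functional_def continuous_form_def
  by (blast intro: bilinear_on_right)

text \<open>Cauchy-Schwarz, with the ambient norm dominated by \<open>n\<close>. This makes the mass
  terms of the residuals continuous in the norm of the state space.\<close>

lemma continuous_functional_inner:
  assumes "\<And>v. v \<in> V \<Longrightarrow> norm v \<le> M * n v"
  shows "continuous_functional V n (\<lambda>v. x \<bullet> v)"
proof -
  have "\<bar>x \<bullet> v\<bar> \<le> (norm x * M) * n v" if "v \<in> V" for v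
    using Cauchy_Schwarz_ineq2[of x v] mult_left_mono[OF assms[OF that] norm_ge_zero[of x]]
    by (simp add: mult.assoc)
  moreover have "linear_on V (\<lambda>v. x \<bullet> v)"
    by (auto simp: linear_on_def inner_add_right)
  ultimately show ?thesis
    unfolding continuous_functional_def by blast
qed

text \<open>Continuity bounds the quotients from above, so their \<open>Sup\<close> dominates each
  of them. At \<open>v = 0\<close> there is no quotient and both sides are 0.\<close>

lemma dual_norm_bound:
  assumes "continuous_functional V n r" "\<And>v. v \<in> V \<Longrightarrow> v \<noteq> 0 \<Longrightarrow> 0 < n v" "n 0 = 0" "v \<in> V"
  shows "r v \<le> dual_norm V n r * n v"
proof (cases "v = 0")
  case True
  then show ?thesis
    using assms linear_on_0[of V r] by (simp add: continuous_functional_def)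
next
  case False
  obtain M where M: "\<forall>v\<in>V. \<bar>r v\<bar> \<le> M * n v"
    using assms(1) by (auto simp: continuous_functional_def)
  have "r v / n v \<le> M" if "v \<in> V - {0}" for v
  proof -
    have "r v \<le> M * n v" using M that by force
    then show ?thesis using assms(2)[of v] that by (simp add: pos_divide_le_eq)
  qed
  \<comment> \<open>The maximum also bounds the inserted 0; the sign of \<open>M\<close> is not
    known.\<close>
  then have "bdd_above (insert 0 {r v / n v |v. v \<in> V - {0}})"
    by (intro bdd_aboveI[of _ "max 0 M"]) (auto simp: le_max_iff_disj)
  then have "r v / n v \<le> dual_norm V n r"
    unfolding dual_norm_def using assms(4) False by (intro cSup_upper) auto
  then show ?thesis
    using assms(2)[OF assms(4) False] by (simp add: pos_divide_le_eq)
qed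

text \<open>The argument is that of the dual norm. Nonnegativity comes from the inserted 0 and later
  allows inequalities to be multiplied by \<open>\<gamma>b\<close>.\<close>

lemma form_norm_bound:
  assumes "continuous_form V n W n' b"
    and "\<And>v. v \<in> V \<Longrightarrow> v \<noteq> 0 \<Longrightarrow> 0 < n v" "n 0 = 0"
    and "\<And>w. w \<in> W \<Longrightarrow> w \<noteq> 0 \<Longrightarrow> 0 < n' w" "n' 0 = 0"
    and "v \<in> V" "w \<in> W"
  shows "b v w \<le> form_norm V n W n' b * n v * n' w" and "0 \<le> form_norm V n W n' b"
proof -
  obtain M where M: "\<forall>v\<in>V. \<forall>w\<in>W. \<bar>b v w\<bar> \<le> M * n v * n' w"
    using assms(1) by (auto simp: continuous_form_def)
  have "b v w / (n v * n' w) \<le> M" if "v \<in> V - {0}" "w \<in> W - {0}" for v w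
  proof -
    have "b v w \<le> M * n v * n' w" using M that by force
    then show ?thesis using assms(2)[of v] assms(4)[of w] that
      by (simp add: pos_divide_le_eq mult.assoc)
  qed
  then have bdd: "bdd_above (insert 0 {b v w / (n v * n' w) |v w. v \<in> V - {0} \<and> w \<in> W - {0}})"
    by (intro bdd_aboveI[of _ "max 0 M"]) (auto simp: le_max_iff_disj)
  then show "0 \<le> form_norm V n W n' b"
    unfolding form_norm_def by (intro cSup_upper) auto
  show "b v w \<le> form_norm V n W n' b * n v * n' w"
  proof (cases "v = 0 \<or> w = 0")
    case True
    then show ?thesis using M assms by force
  next
    case False
    then have "b v w / (n v * n' w) \<le> form_norm V n W n' b"
      unfolding form_norm_def using assms(6,7) bdd by (intro cSup_upper) auto
    then show ?thesis
      using assms(2)[of v] assms(4)[of w] assms(6,7) False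
      by (simp add: pos_divide_le_eq mult.assoc)
  qed
qed

text \<open>Some finite bound \<open>M\<close> must be known beforehand to bound the quotients; the
  supremum then replaces it as the constant.\<close>

lemma operator_norm_bound:
  assumes "\<And>v. v \<in> V \<Longrightarrow> n' (C v) \<le> M * n v"
    and "\<And>v. v \<in> V \<Longrightarrow> v \<noteq> 0 \<Longrightarrow> 0 < n v" "n 0 = 0" "v \<in> V"
  shows "n' (C v) \<le> operator_norm V n n' C * n v"
proof (cases "v = 0")
  case True
  then show ?thesis using assms(1)[OF assms(4)] assms(3) by simp
next
  case False
  have "n' (C v) / n v \<le> M" if "v \<in> V - {0}" for v
    using assms(1,2)[of v] that by (simp add: pos_divide_le_eq)
  then have "bdd_above (insert 0 {n' (C v) / n v |v. v \<in> V - {0}})"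
    by (intro bdd_aboveI[of _ "max 0 M"]) (auto simp: le_max_iff_disj)
  then have "n' (C v) / n v \<le> operator_norm V n n' C"
    unfolding operator_norm_def using assms(4) False by (intro cSup_upper) auto
  then show ?thesis
    using assms(2)[OF assms(4) False] by (simp add: pos_divide_le_eq)
qed

text \<open>Each quotient lies above the infimum. The infimum is taken in \<open>ereal\<close>,
  where it always exists and is infinite on the trivial space.\<close>

lemma coercivity_const_bound:
  assumes "ereal \<alpha> \<le> coercivity_const V n a" "bilinear_on V V a"
    and "\<And>v. v \<in> V \<Longrightarrow> v \<noteq> 0 \<Longrightarrow> 0 < n v" "n 0 = 0" "v \<in> V"
  shows "\<alpha> * (n v)\<^sup>2 \<le> a v v"
proof (cases "v = 0")
  case True
  then show ?thesis
    using linear_on_0[OF bilinear_on_right[OF assms(2)], of 0] assms by simp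
next
  case False
  then have "ereal \<alpha> \<le> ereal (a v v / (n v)\<^sup>2)"
    using assms(1,5) unfolding coercivity_const_def by (blast intro: order_trans INF_lower)
  then show ?thesis
    using assms(3)[OF assms(5) False] by (simp add: pos_le_divide_eq)
qed


section \<open>The discrete state equation\<close>

text \<open>
  Adding a vector \<open>b\<close> to the spanning set: subtracting from \<open>b\<close> the solution for the functional
  \<open>A b\<close> gives \<open>c\<close> with \<open>A c v = 0\<close> for all old \<open>v\<close>, and only the multiple of \<open>c\<close> has to be
  adjusted.
\<close>

lemma positive_form_solvable:
  assumes "finite B" "bilinear_on (span B) (span B) A"
    and "\<And>v. v \<in> span B \<Longrightarrow> v \<noteq> 0 \<Longrightarrow> 0 < A v v" "linear_on (span B) g"
  shows "\<exists>x\<in>span B. \<forall>v\<in>span B. A x v = g v"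
  using assms
proof (induction B arbitrary: g rule: finite_induct)
  case empty
  then have "A 0 0 = 0" "g 0 = 0"
    using linear_on_0[of "{0}" "A 0"] linear_on_0[of "{0}" g]
    by (simp_all add: bilinear_on_def)
  then show ?case by simp
next
  case (insert b B)
  let ?V = "span B" and ?W = "span (insert b B)"
  have sub: "?V \<subseteq> ?W" by (intro span_mono) auto
  have lin: "linear_on ?W (A x)" "linear_on ?W (\<lambda>x. A x v)" if "x \<in> ?W" "v \<in> ?W" for x v
    using insert.prems(1) that by (auto simp: bilinear_on_def)
  note sub_lin = linear_on_subset[OF _ sub]
  have "bilinear_on ?V ?V A"
    unfolding bilinear_on_def using sub_lin[OF lin(1)] sub_lin[OF lin(2)] sub
    by (meson subsetD)
  then have IH: "\<exists>x\<in>?V. \<forall>v\<in>?V. A x v = g v" if "linear_on ?W g" for g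
    using insert.IH insert.prems(2) sub_lin[OF that] sub by (meson subsetD)
  have bW: "b \<in> ?W" by (simp add: span_base)
  obtain w where w: "w \<in> ?V" "\<forall>v\<in>?V. A w v = A b v"
    using IH[OF lin(1)[OF bW bW]] by metis
  obtain x where x: "x \<in> ?V" "\<forall>v\<in>?V. A x v = g v"
    using IH[OF insert.prems(3)] by metis
  show ?case
  proof (cases "b \<in> ?V")
    case True
    then have "?W = ?V" by (metis span_redundant)
    then show ?thesis using x by auto
  next
    case False
    define c where "c = b - w"
    have cW: "c \<in> ?W" and wW: "w \<in> ?W" and xW: "x \<in> ?W"
      unfolding c_def using w x sub bW by (auto intro: span_diff)
    have "c \<noteq> 0" using False w by (auto simp: c_def)
    then have cc: "0 < A c c" using insert.prems(2) cW by blast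
    have c0: "A c v = 0" if "v \<in> ?V" for v
      using linear_on_diff[OF lin(2)[OF bW], of v b w] that sub w bW wW by (auto simp: c_def)
    \<comment> \<open>With this value, testing with \<open>c\<close> gives
      \<open>A x c + t * A c c = g c\<close>.\<close>
    define t where "t = (g c - A x c) / A c c"
    have Az: "A (x + t *\<^sub>R c) v = A x v + t * A c v" if "v \<in> ?W" for v
      using lin(2)[OF xW that] xW cW by (simp add: linear_on_def span_scale)
    have "A (x + t *\<^sub>R c) v = g v" if v: "v \<in> ?W" for v
    proof -
      \<comment> \<open>Since \<open>b\<close> and \<open>c\<close> differ by \<open>w\<close> in
        the old span, \<open>v\<close> is also an old vector plus a multiple of
        \<open>c\<close>.\<close>
      obtain k where k: "v - k *\<^sub>R b \<in> ?V" using v by (auto simp: span_insert)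
      define v' where "v' = v - k *\<^sub>R c"
      have "v' = (v - k *\<^sub>R b) + k *\<^sub>R w" by (simp add: v'_def c_def algebra_simps)
      then have v': "v' \<in> ?V" using k w by (simp add: span_add span_scale)
      have vv: "v = v' + k *\<^sub>R c" by (simp add: v'_def)
      have v'W: "v' \<in> ?W" using v' sub by blast
      have *: "r v = r v' + k * r c" if "linear_on ?W r" for r
        using that v'W cW unfolding vv by (simp add: linear_on_def span_scale)
      have "A x v = g v' + k * A x c" "A c v = k * A c c"
        using *[OF lin(1)[OF xW v]] *[OF lin(1)[OF cW v]] x v' c0 by auto
      moreover have "k * (A x c + t * A c c) = k * g c" using cc by (simp add: t_def)
      ultimately show ?thesis
        using Az[OF v] *[OF insert.prems(3)] by (simp add: algebra_simps)
    qed
    then show ?thesis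
      using xW cW by (intro bexI[of _ "x + t *\<^sub>R c"]) (auto intro: span_add span_scale)
  qed
qed

text \<open>One step has the form \<open>x \<bullet> v + \<tau> * a x v\<close>, which is positive
  definite because its first term is and its second is nonnegative; recursion over time does the
  rest. \<open>s0\<close> may lie outside \<open>Y\<close>, as an initial control may, and
  \<open>g k\<close> drives the step from \<open>k\<close> to \<open>Suc k\<close>.\<close>

lemma implicit_euler_solvable:
  fixes a :: "'v::real_inner \<Rightarrow> 'v \<Rightarrow> real"
  assumes "finite_dim_subspace Y" "bilinear_on Y Y a" "0 \<le> \<tau>"
    and "\<And>v. v \<in> Y \<Longrightarrow> 0 \<le> a v v" and "\<And>k. linear_on Y (g k)"
  shows "\<exists>s. s 0 = s0 \<and> (\<forall>k. s (Suc k) \<in> Y \<and>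
           (\<forall>v\<in>Y. s (Suc k) \<bullet> v + \<tau> * a (s (Suc k)) v = s k \<bullet> v + g k v))"
proof -
  obtain B where B: "finite B" "Y = span B"
    using assms(1) by (auto simp: finite_dim_subspace_def)
  let ?A = "\<lambda>x v. x \<bullet> v + \<tau> * a x v"
  have "\<exists>x\<in>Y. \<forall>v\<in>Y. ?A x v = x' \<bullet> v + g k v" for x' k
    unfolding B(2)
  proof (rule positive_form_solvable[OF B(1)])
    show "bilinear_on (span B) (span B) ?A"
      using assms(2) unfolding B(2) by (auto simp: bilinear_on_def linear_on_def algebra_simps)
    show "0 < ?A v v" if "v \<in> span B" "v \<noteq> 0" for v
      using assms(3) assms(4)[of v] that B(2) by (simp add: add_pos_nonneg)
    show "linear_on (span B) (\<lambda>v. x' \<bullet> v + g k v)"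
      using assms(5)[of k] unfolding B(2) by (auto simp: linear_on_def algebra_simps)
  qed
  then obtain S where S: "\<And>x' k. S x' k \<in> Y \<and> (\<forall>v\<in>Y. ?A (S x' k) v = x' \<bullet> v + g k v)"
    by metis
  show ?thesis
    by (intro exI[of _ "rec_nat s0 (\<lambda>k x. S x k)"]) (simp add: S)
qed

text \<open>The equation is tested with \<open>x k\<close> itself; the time difference then
  dominates a telescoping half-difference of squared norms. The induction carries the last squared
  norm along, and it is dropped at the end.\<close>

lemma implicit_euler_energy:
  fixes x :: "nat \<Rightarrow> 'v::real_inner"
  assumes "\<And>k. k \<in> {1..K} \<Longrightarrow> (x k - x (k - 1)) \<bullet> x k + \<tau> * a (x k) (x k) = \<tau> * g k"
    and "\<And>k. k \<in> {1..K} \<Longrightarrow> \<alpha> * (n (x k))\<^sup>2 \<le> a (x k) (x k)" and "0 \<le> \<tau>"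
  shows "\<alpha> * (\<tau> * (\<Sum>k=1..K. (n (x k))\<^sup>2)) \<le> (norm (x 0))\<^sup>2 / 2 + \<tau> * (\<Sum>k=1..K. g k)"
proof -
  have "\<alpha> * (\<tau> * (\<Sum>k=1..m. (n (x k))\<^sup>2)) + (norm (x m))\<^sup>2 / 2
      \<le> (norm (x 0))\<^sup>2 / 2 + \<tau> * (\<Sum>k=1..m. g k)" if "m \<le> K" for m
    using that
  proof (induction m)
    case (Suc m)
    have "\<tau> * (\<alpha> * (n (x (Suc m)))\<^sup>2) \<le> \<tau> * a (x (Suc m)) (x (Suc m))"
      using assms(2)[of "Suc m"] assms(3) Suc.prems by (intro mult_left_mono) auto
    also have "\<dots> = \<tau> * g (Suc m) - (x (Suc m) - x m) \<bullet> x (Suc m)"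
      using assms(1)[of "Suc m"] Suc.prems by simp
    \<comment> \<open>Twice \<open>(x' - x) \<bullet> x'\<close> is the squared norm of
      \<open>x'\<close> minus that of \<open>x\<close> plus that of \<open>x' - x\<close>; the last
      square is discarded.\<close>
    also have "\<dots> \<le> \<tau> * g (Suc m) - (norm (x (Suc m)))\<^sup>2 / 2 + (norm (x m))\<^sup>2 / 2"
      using inner_ge_zero[of "x (Suc m) - x m"]
      by (simp add: power2_norm_eq_inner inner_diff_left inner_diff_right inner_commute)
    finally show ?case
      using Suc by (simp add: algebra_simps)
  qed simp
  from this[of K] show ?thesis
    using zero_le_power2[of "norm (x K)"] by linarith
qed

text \<open>Moves the time difference from the state to the adjoint. The final boundary term
  vanishes for adjoints with \<open>p (K + 1) = 0\<close>.\<close>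

lemma summation_by_parts:
  fixes s p :: "nat \<Rightarrow> 'v::real_inner"
  shows "(\<Sum>k=1..K. (s k - s (k - 1)) \<bullet> p k)
       = (\<Sum>k=1..K. s k \<bullet> (p k - p (k + 1))) - s 0 \<bullet> p 1 + s K \<bullet> p (K + 1)"
  by (induction K) (simp_all add: algebra_simps)


section \<open>Stationarity of the optimal control\<close>

text \<open>Turns minimality along a line into a vanishing first variation: for small
  \<open>t\<close> of the sign opposite to \<open>L\<close>, the linear term would dominate.\<close>

lemma linear_term_eq_0:
  fixes L Q :: real
  assumes "\<And>t. 0 \<le> t * L + t\<^sup>2 * Q"
  shows "L = 0"
proof (rule ccontr)
  assume "L \<noteq> 0"
  define q where "q = \<bar>Q\<bar> + 1"
  \<comment> \<open>The minimiser of the polynomial with \<open>Q\<close> replaced by its strictly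
    positive upper bound \<open>q\<close>.\<close>
  define t where "t = - L / (2 * q)"
  have q: "0 < q" "Q \<le> q" by (simp_all add: q_def)
  have "t * L + t\<^sup>2 * Q \<le> t * L + t\<^sup>2 * q"
    using q by (intro add_left_mono mult_left_mono) auto
  also have "\<dots> = - L\<^sup>2 / (4 * q)"
    using q by (simp add: t_def power2_eq_square field_simps)
  also have "\<dots> < 0" using \<open>L \<noteq> 0\<close> q by (simp add: divide_neg_pos)
  finally show False using assms[of t] by linarith
qed

lemma ip_norm_square_add_scale:
  assumes "inner_product_on V ip" "subspace V" "x \<in> V" "z \<in> V"
  shows "(ip_norm ip (x + t *\<^sub>R z))\<^sup>2 = (ip_norm ip x)\<^sup>2 + t * (2 * ip x z) + t\<^sup>2 * (ip_norm ip z)\<^sup>2"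
proof -
  have b: "bilinear_on V V ip" and sym: "ip z x = ip x z"
    using assms by (auto simp: inner_product_on_def)
  have tz: "t *\<^sub>R z \<in> V" and xtz: "x + t *\<^sub>R z \<in> V"
    using assms by (auto intro: subspace_add subspace_scale)
  have "ip (x + t *\<^sub>R z) w = ip x w + t * ip z w" if "w \<in> V" for w
    using linear_on_add[OF bilinear_on_left[OF b that] assms(3) tz]
      linear_on_scale[OF bilinear_on_left[OF b that] assms(4)] by simp
  moreover have "ip w (x + t *\<^sub>R z) = ip w x + t * ip w z" if "w \<in> V" for w
    using linear_on_add[OF bilinear_on_right[OF b that] assms(3) tz]
      linear_on_scale[OF bilinear_on_right[OF b that] assms(4)] by simp
  ultimately have "ip (x + t *\<^sub>R z) (x + t *\<^sub>R z) = ip x x + t * (2 * ip x z) + t\<^sup>2 * ip z z"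
    using assms(3,4) tz xtz sym by (simp add: algebra_simps power2_eq_square)
  then show ?thesis
    using ip_norm_square[OF assms(1)] assms(3,4) xtz by simp
qed

text \<open>\<open>ip x x + ip x z + ip z z / 4\<close> is the squared norm of
  \<open>x + z / 2\<close>, hence nonnegative.\<close>

lemma neg_inner_product_le:
  assumes "inner_product_on V ip" "subspace V" "x \<in> V" "z \<in> V"
  shows "- ip (x + z) x \<le> ip z z / 4"
proof -
  have "bilinear_on V V ip" and "ip x z = ip z x"
    using assms by (auto simp: inner_product_on_def)
  then have "ip (x + z) x = ip x x + ip x z"
    using linear_on_add[OF bilinear_on_left[of V V ip x] assms(3,4)] assms(3) by simp
  moreover have "0 \<le> ip x x + ip x z + ip z z / 4"
    using zero_le_power2[of "ip_norm ip (x + (1/2) *\<^sub>R z)"]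
      ip_norm_square_add_scale[OF assms, of "1/2"]
      ip_norm_square[OF assms(1,3)] ip_norm_square[OF assms(1,4)]
    by (simp add: power_divide)
  ultimately show ?thesis by simp
qed

lemma norm_square_add_scale:
  fixes x z :: "'v::real_inner"
  shows "(norm (x + t *\<^sub>R z))\<^sup>2 = (norm x)\<^sup>2 + t * (2 * (x \<bullet> z)) + t\<^sup>2 * (norm z)\<^sup>2"
  unfolding power2_norm_eq_inner
  by (simp add: algebra_simps inner_commute power2_eq_square)

text \<open>\<open>(s, w)\<close> solves the homogeneous constraints, so the line through the
  optimum in this direction stays feasible. The cost along it is a quadratic polynomial in the step
  length, and minimality for both signs forces the linear coefficient \<open>?L\<close> to
  vanish.\<close>

lemma optimal_stationary:
  fixes C :: "'v::real_inner \<Rightarrow> 'z::real_vector"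
  assumes opt: "is_arg_min (cost \<tau> K C ipD u_d z_d) (feasible \<tau> K a b f H V W0 W) (y, u)"
    and ipD: "inner_product_on UNIV ipD"
    and C: "\<And>v w t. v \<in> V \<Longrightarrow> w \<in> V \<Longrightarrow> C (v + t *\<^sub>R w) = C v + t *\<^sub>R C w"
    and sub: "subspace V" "subspace W0" "subspace W" "subspace H"
    and bil: "bilinear_on V V a" "bilinear_on W V b"
    and s: "s 0 \<in> H" "\<And>k. k \<in> {1..K} \<Longrightarrow> s k \<in> V"
    and w: "w 0 \<in> W0" "\<And>k. k \<in> {1..K} \<Longrightarrow> w k \<in> W"
    and s0: "\<And>v. v \<in> V \<Longrightarrow> s 0 \<bullet> v = w 0 \<bullet> v"
    and sw: "\<And>k v. k \<in> {1..K} \<Longrightarrow> v \<in> V \<Longrightarrow>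
      s k \<bullet> v + \<tau> * a (s k) v = s (k - 1) \<bullet> v + \<tau> * b (w k) v"
  shows "(u 0 - u_d 0) \<bullet> w 0 + \<tau> * (\<Sum>k=1..K. (u k - u_d k) \<bullet> w k)
       + \<tau> * (\<Sum>k=1..K. ipD (C (y k) - z_d k) (C (s k))) = 0" (is "?L = 0")
proof (rule linear_term_eq_0)
  fix t :: real
  \<comment> \<open>The second-order coefficient: the cost of the direction with zero data.\<close>
  let ?Q = "(norm (w 0))\<^sup>2 / 2 + \<tau> / 2 * (\<Sum>k=1..K. (norm (w k))\<^sup>2)
    + \<tau> / 2 * (\<Sum>k=1..K. (ip_norm ipD (C (s k)))\<^sup>2)"
  let ?y = "\<lambda>k. y k + t *\<^sub>R s k" and ?u = "\<lambda>k. u k + t *\<^sub>R w k"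
  have feas: "feasible \<tau> K a b f H V W0 W (y, u)"
    and min: "\<And>q. feasible \<tau> K a b f H V W0 W q \<Longrightarrow>
      cost \<tau> K C ipD u_d z_d (y, u) \<le> cost \<tau> K C ipD u_d z_d q"
    using opt by (auto simp: is_arg_min_linorder)
  have yV: "y k \<in> V" and uW: "u k \<in> W" if "k \<in> {1..K}" for k
    using feas that by (auto simp: feasible_def)
  have "feasible \<tau> K a b f H V W0 W (?y, ?u)"
    unfolding feasible_def split_conv
  proof (intro conjI ballI)
    show "?y 0 \<in> H" "?u 0 \<in> W0"
      using feas s w sub by (auto simp: feasible_def intro: subspace_add subspace_scale)
    show "?y k \<in> V" "?u k \<in> W" if "k \<in> {1..K}" for k
      using yV[OF that] uW[OF that] s(2)[OF that] w(2)[OF that] sub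
      by (auto intro: subspace_add subspace_scale)
    show "?y 0 \<bullet> v = ?u 0 \<bullet> v" if "v \<in> V" for v
      using feas s0[OF that] that by (simp add: feasible_def inner_add_left)
    fix k v assume k: "k \<in> {1..K}" and v: "v \<in> V"
    have "a (?y k) v = a (y k) v + t * a (s k) v"
      using bilinear_on_left[OF bil(1) v] yV[OF k] s(2)[OF k] sub(1)
      by (simp add: linear_on_def subspace_scale)
    moreover have "b (?u k) v = b (u k) v + t * b (w k) v"
      using bilinear_on_left[OF bil(2) v] uW[OF k] w(2)[OF k] sub(3)
      by (simp add: linear_on_def subspace_scale)
    moreover have "y k \<bullet> v + \<tau> * a (y k) v = y (k - 1) \<bullet> v + \<tau> * b (u k) v + \<tau> * f v"
      using feas k v by (simp add: feasible_def)
    moreover have "t * (s k \<bullet> v + \<tau> * a (s k) v) = t * (s (k - 1) \<bullet> v + \<tau> * b (w k) v)"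
      using sw[OF k v] by simp
    ultimately show "?y k \<bullet> v + \<tau> * a (?y k) v = ?y (k - 1) \<bullet> v + \<tau> * b (?u k) v + \<tau> * f v"
      by (simp add: inner_add_left algebra_simps)
  qed
  from min[OF this]
  have "cost \<tau> K C ipD u_d z_d (y, u) \<le> cost \<tau> K C ipD u_d z_d (?y, ?u)" .
  moreover have "cost \<tau> K C ipD u_d z_d (?y, ?u) = cost \<tau> K C ipD u_d z_d (y, u) + t * ?L + t\<^sup>2 * ?Q"
  proof -
    have u: "(norm (?u k - u_d k))\<^sup>2
        = (norm (u k - u_d k))\<^sup>2 + t * (2 * ((u k - u_d k) \<bullet> w k)) + t\<^sup>2 * (norm (w k))\<^sup>2" for k
      using norm_square_add_scale[of "u k - u_d k" t "w k"] by (simp add: add_diff_eq diff_add_eq)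
    have y: "(ip_norm ipD (C (?y k) - z_d k))\<^sup>2
        = (ip_norm ipD (C (y k) - z_d k))\<^sup>2 + t * (2 * ipD (C (y k) - z_d k) (C (s k)))
          + t\<^sup>2 * (ip_norm ipD (C (s k)))\<^sup>2" if "k \<in> {1..K}" for k
      using ip_norm_square_add_scale[OF ipD, of "C (y k) - z_d k" "C (s k)" t]
        C[OF yV s(2), OF that that, of t] by (simp add: add_diff_eq diff_add_eq)
    have Sy: "(\<Sum>k=1..K. (ip_norm ipD (C (?y k) - z_d k))\<^sup>2)
        = (\<Sum>k=1..K. (ip_norm ipD (C (y k) - z_d k))\<^sup>2)
          + t * (2 * (\<Sum>k=1..K. ipD (C (y k) - z_d k) (C (s k))))
          + t\<^sup>2 * (\<Sum>k=1..K. (ip_norm ipD (C (s k)))\<^sup>2)"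
      using y by (simp add: sum.distrib sum_distrib_left)
    have Su: "(\<Sum>k=1..K. (norm (?u k - u_d k))\<^sup>2)
        = (\<Sum>k=1..K. (norm (u k - u_d k))\<^sup>2)
          + t * (2 * (\<Sum>k=1..K. (u k - u_d k) \<bullet> w k))
          + t\<^sup>2 * (\<Sum>k=1..K. (norm (w k))\<^sup>2)"
      by (simp add: u sum.distrib sum_distrib_left)
    show ?thesis
      unfolding cost_def split_conv Sy Su u[of 0] by (simp add: field_simps)
  qed
  ultimately show "0 \<le> t * ?L + t\<^sup>2 * ?Q" by linarith
qed


section \<open>Error bound\<close>

text \<open>The weight is split as \<open>sqrt \<tau> * sqrt \<tau>\<close>, one root for each
  factor of the unweighted inequality.\<close>

lemma weighted_Cauchy_Schwarz:
  fixes r x :: "nat \<Rightarrow> real"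
  assumes "0 \<le> \<tau>"
  shows "\<tau> * (\<Sum>k\<in>A. r k * x k) \<le> sqrt (\<tau> * (\<Sum>k\<in>A. (r k)\<^sup>2)) * sqrt (\<tau> * (\<Sum>k\<in>A. (x k)\<^sup>2))"
proof -
  have "(\<Sum>k\<in>A. r k * x k) \<le> (\<Sum>k\<in>A. \<bar>r k\<bar> * \<bar>x k\<bar>)"
    by (intro sum_mono) (simp flip: abs_mult)
  also have "\<dots> \<le> L2_set r A * L2_set x A" by (rule L2_set_mult_ineq)
  finally have "\<tau> * (\<Sum>k\<in>A. r k * x k) \<le> \<tau> * (L2_set r A * L2_set x A)"
    using assms by (rule mult_left_mono)
  also have "\<dots> = (sqrt \<tau> * sqrt \<tau>) * (L2_set r A * L2_set x A)"
    using assms by simp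
  also have "\<dots> = sqrt (\<tau> * (\<Sum>k\<in>A. (r k)\<^sup>2)) * sqrt (\<tau> * (\<Sum>k\<in>A. (x k)\<^sup>2))"
    by (simp only: L2_set_def real_sqrt_mult ac_simps)
  finally show ?thesis .
qed

text \<open>The dual norm bound at every time step, followed by Cauchy-Schwarz in time.\<close>

lemma time_dual_norm_bound:
  assumes "0 \<le> \<tau>" "\<And>k. k \<in> {1..K} \<Longrightarrow> continuous_functional V n (r k)"
    and "\<And>v. v \<in> V \<Longrightarrow> v \<noteq> 0 \<Longrightarrow> 0 < n v" "n 0 = 0" "\<And>k. k \<in> {1..K} \<Longrightarrow> x k \<in> V"
  shows "\<tau> * (\<Sum>k=1..K. r k (x k)) \<le> time_dual_norm \<tau> K V n r * sqrt (\<tau> * (\<Sum>k=1..K. (n (x k))\<^sup>2))"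
proof -
  have "\<tau> * (\<Sum>k=1..K. r k (x k)) \<le> \<tau> * (\<Sum>k=1..K. dual_norm V n (r k) * n (x k))"
    using assms by (intro mult_left_mono sum_mono dual_norm_bound) auto
  also have "\<dots> \<le> time_dual_norm \<tau> K V n r * sqrt (\<tau> * (\<Sum>k=1..K. (n (x k))\<^sup>2))"
    unfolding time_dual_norm_def using assms(1) by (rule weighted_Cauchy_Schwarz)
  finally show ?thesis .
qed

text \<open>Cauchy-Schwarz in the plane, through the norm on pairs. It later joins the initial
  control with the model error.\<close>

lemma real_Cauchy_Schwarz_2:
  fixes r s x y :: real
  shows "r * x + s * y \<le> sqrt (r\<^sup>2 + s\<^sup>2) * sqrt (x\<^sup>2 + y\<^sup>2)"
  using norm_cauchy_schwarz[of "(r, s)" "(x, y)"] by (simp add: norm_Pair)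

text \<open>Completing the square; the bound is the larger root of the corresponding
  equation.\<close>

lemma quadratic_root_bound:
  fixes E c d :: real
  assumes "E\<^sup>2 \<le> 2 * c * E + d"
  shows "E \<le> c + sqrt (c\<^sup>2 + d)"
proof -
  have "(E - c)\<^sup>2 \<le> c\<^sup>2 + d" using assms by (simp add: power2_diff mult.commute mult.left_commute)
  then have "E - c \<le> sqrt (c\<^sup>2 + d)" using real_le_rsqrt by blast
  then show ?thesis by simp
qed

text \<open>Serves the stationarity argument, where the initial state is varied inside
  \<open>l2_on \<Omega>\<close> in the direction of a control error.\<close>

lemma subspace_l2_on: "subspace (l2_on \<Omega>)"
proof -
  have "vanishes_off \<Omega> 0" by transfer simp
  moreover have "vanishes_off \<Omega> (u + v)" if "vanishes_off \<Omega> u" "vanishes_off \<Omega> v" for u v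
    using that by transfer auto
  moreover have "vanishes_off \<Omega> (c *\<^sub>R u)" if "vanishes_off \<Omega> u" for c u
    using that by transfer auto
  ultimately show ?thesis by (auto simp: subspace_def l2_on_def)
qed

text \<open>Links the ambient norm to the norm of the state space, which is equivalent to the
  \<open>H1\<close> norm.\<close>

lemma norm_le_H1_norm: "norm u \<le> H1_norm \<Omega> u"
  unfolding H1_norm_def by (intro real_le_rsqrt) (simp add: sum_nonneg)

theorem proposition3:
  fixes \<Omega> :: "(real^'d) set"
    and Ye Y U Y_N U_N0 U_N :: "'d l2 set"
    and ipY :: "'d l2 \<Rightarrow> 'd l2 \<Rightarrow> real"
    and \<D> :: "(real^'p) set"
    and T \<tau> \<alpha>_low :: real and K Qa :: nat
    and a :: "real^'p \<Rightarrow> 'd l2 \<Rightarrow> 'd l2 \<Rightarrow> real"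
    and \<Theta> :: "nat \<Rightarrow> real^'p \<Rightarrow> real"
    and aq :: "nat \<Rightarrow> 'd l2 \<Rightarrow> 'd l2 \<Rightarrow> real"
    and b :: "'d l2 \<Rightarrow> 'd l2 \<Rightarrow> real"
    and f :: "'d l2 \<Rightarrow> real"
    and ipD :: "real^'l \<Rightarrow> real^'l \<Rightarrow> real"
    and h :: "'l \<Rightarrow> 'd l2 \<Rightarrow> real"
    and C :: "'d l2 \<Rightarrow> real^'l"
    and \<alpha>_LB :: "real^'p \<Rightarrow> real"
    and u_d :: "nat \<Rightarrow> 'd l2" and z_d :: "nat \<Rightarrow> real^'l"
    and \<mu> :: "real^'p"
    and y u y_N p_N u_N :: "nat \<Rightarrow> 'd l2"
    and \<gamma>b \<gamma>c Ry Rp Ru r0 c1 c2 :: real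
  assumes "bounded_lipschitz_domain \<Omega>"
    and "hilbert_space_on Ye ipY" and "H1_0 \<Omega> \<subseteq> Ye" and "Ye \<subseteq> H1 \<Omega>"
    and "\<exists>c>0. \<exists>c'>0. \<forall>v\<in>Ye. c * H1_norm \<Omega> v \<le> ip_norm ipY v \<and> ip_norm ipY v \<le> c' * H1_norm \<Omega> v"
    and "finite_dim_subspace Y" and "Y \<subseteq> Ye"
    and "finite_dim_subspace U" and "U \<subseteq> l2_on \<Omega>"
    and "compact \<D>"
    and "0 < T" and "1 \<le> K" and "\<tau> = T / real K"
    and "continuous_form U norm Y (ip_norm ipY) b"
    and "\<forall>\<nu>\<in>\<D>. continuous_form Y (ip_norm ipY) Y (ip_norm ipY) (a \<nu>)"
    and "\<forall>q<Qa. continuous_on \<D> (\<Theta> q) \<and> continuous_form Y (ip_norm ipY) Y (ip_norm ipY) (aq q)"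
    and "\<forall>\<nu>\<in>\<D>. \<forall>w\<in>Y. \<forall>v\<in>Y. a \<nu> w v = (\<Sum>q<Qa. \<Theta> q \<nu> * aq q w v)"
    and "0 < \<alpha>_low"
    and "\<forall>\<nu>\<in>\<D>. \<alpha>_low \<le> \<alpha>_LB \<nu> \<and>
           ereal (\<alpha>_LB \<nu>) \<le> coercivity_const Y (ip_norm ipY) (a \<nu>)"
    and "continuous_functional Y (ip_norm ipY) f"
    and "inner_product_on UNIV ipD"
    and "\<forall>i. continuous_functional Y (ip_norm ipY) (h i)"
    and "\<forall>v\<in>Y. C v = (\<chi> i. h i v)"
    and "\<forall>k\<le>K. u_d k \<in> U"
    and "subspace Y_N" and "Y_N \<subseteq> Y"
    and "subspace U_N0" and "U_N0 \<subseteq> U"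
    and "subspace U_N" and "U_N \<subseteq> U"
    and "\<mu> \<in> \<D>"
    and FE_optimal: "is_arg_min (cost \<tau> K C ipD u_d z_d)
           (feasible \<tau> K (a \<mu>) b f (l2_on \<Omega>) Y U U) (y, u)"
    and RB_optimal: "is_arg_min (cost \<tau> K C ipD u_d z_d)
           (feasible \<tau> K (a \<mu>) b f (l2_on \<Omega>) Y_N U_N0 U_N) (y_N, u_N)"
    and RB_adjoint: "adjoint_solution \<tau> K (a \<mu>) C ipD z_d Y_N y_N p_N"
    and RB_initial: "\<forall>\<phi>\<in>Y. y_N 0 \<bullet> \<phi> = u_N 0 \<bullet> \<phi>"
    and "\<gamma>b = form_norm U norm Y (ip_norm ipY) b"
    and "\<gamma>c = operator_norm Y (ip_norm ipY) (ip_norm ipD) C"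
    and "Ry = time_dual_norm \<tau> K Y (ip_norm ipY) (res_y \<tau> (a \<mu>) b f y_N u_N)"
    and "Rp = time_dual_norm \<tau> K Y (ip_norm ipY) (res_p \<tau> (a \<mu>) C ipD z_d y_N p_N)"
    and "Ru = time_dual_norm \<tau> K U norm (res_u b u_d p_N u_N)"
    and "r0 = dual_norm U norm (res_u0 u_d p_N u_N)"
    and "c1 = 1 / 2 * (sqrt (r0\<^sup>2 + Ru\<^sup>2)
                + sqrt (2 * \<gamma>b\<^sup>2 / (\<alpha>_LB \<mu>)\<^sup>2 + 1 / \<alpha>_LB \<mu>) * Rp)"
    and "c2 = 2 * sqrt 2 / \<alpha>_LB \<mu> * Ry * Rp + \<gamma>c\<^sup>2 / (2 * (\<alpha>_LB \<mu>)\<^sup>2) * Ry\<^sup>2"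
  shows "sqrt ((norm (u 0 - u_N 0))\<^sup>2 + \<tau> * (\<Sum>k=1..K. (norm (u k - u_N k))\<^sup>2))
           \<le> c1 + sqrt (c1\<^sup>2 + c2)"
proof -

  \<comment> \<open>Norms, positivity and coercivity\<close>
  let ?n = "ip_norm ipY" and ?a = "a \<mu>" and ?\<alpha> = "\<alpha>_LB \<mu>"
  let ?ry = "res_y \<tau> ?a b f y_N u_N" and ?rp = "res_p \<tau> ?a C ipD z_d y_N p_N"
  let ?ru = "res_u b u_d p_N u_N" and ?r0 = "res_u0 u_d p_N u_N"
  have subY: "subspace Y" and subU: "subspace U"
    using assms(6,8) by (auto simp: finite_dim_subspace_def)
  have ipY: "inner_product_on Y ipY"
    using assms(2,7) by (auto simp: hilbert_space_on_def intro: inner_product_on_subset)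
  note npos = ip_norm_pos[OF ipY] and n0 = ip_norm_0[OF ipY subspace_0[OF subY]]
  obtain c where c: "0 < c" "\<forall>v\<in>Ye. c * H1_norm \<Omega> v \<le> ?n v"
    using assms(5) by blast
  have nle: "norm v \<le> (1 / c) * ?n v" if "v \<in> Y" for v
  proof -
    have "c * norm v \<le> c * H1_norm \<Omega> v"
      using c(1) norm_le_H1_norm by (intro mult_left_mono) auto
    also have "\<dots> \<le> ?n v" using c(2) assms(7) that by blast
    finally show ?thesis using c(1) by (simp add: field_simps)
  qed
  note cf_inner = continuous_functional_inner[of Y _ ?n, OF nle]
  have \<tau>: "0 < \<tau>" using assms(11,12,13) by simp
  have \<alpha>: "0 < ?\<alpha>" using assms(18,19,31) by force
  have acf: "continuous_form Y ?n Y ?n ?a" using assms(15,31) by blast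
  have abil: "bilinear_on Y Y ?a" and bbil: "bilinear_on U Y b"
    using acf assms(14) by (auto simp: continuous_form_def)
  have coercive: "?\<alpha> * (?n v)\<^sup>2 \<le> ?a v v" if "v \<in> Y" for v
    using assms(19,31) abil npos n0 that by (intro coercivity_const_bound[of _ Y]) auto

  \<comment> \<open>Linearity and boundedness of the observation operator\<close>
  have C_add: "C (v + t *\<^sub>R w) = C v + t *\<^sub>R C w" if "v \<in> Y" "w \<in> Y" for v w t
  proof -
    have "h i (v + t *\<^sub>R w) = h i v + t * h i w" for i
      using assms(22) that subY
      by (simp add: continuous_functional_def linear_on_def subspace_scale)
    then show ?thesis
      using assms(23) that subY by (simp add: vec_eq_iff subspace_add subspace_scale)
  qed
  have ipD_bil: "bilinear_on UNIV UNIV ipD" using assms(21) by (simp add: inner_product_on_def)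
  \<comment> \<open>In finite dimensions every bilinear form is bounded; \<open>B\<close> relates
    \<open>ipD\<close> to the Euclidean norm.\<close>
  obtain B where B: "0 \<le> B" "\<And>x z. \<bar>ipD x z\<bar> \<le> B * norm x * norm z"
  proof -
    have "bilinear ipD"
      using ipD_bil by (auto simp: bilinear_def bilinear_on_def linear_on_def intro!: linearI)
    from bilinear_bounded_pos[OF this]
    obtain B where "0 < B" "\<forall>x z. \<bar>ipD x z\<bar> \<le> B * norm x * norm z" by auto
    then show ?thesis by (intro that[of B]) auto
  qed
  obtain M where M: "0 \<le> M" "\<And>v. v \<in> Y \<Longrightarrow> norm (C v) \<le> M * ?n v"
  proof -
    have "\<forall>i. \<exists>M. \<forall>v\<in>Y. \<bar>h i v\<bar> \<le> M * ?n v"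
      using assms(22) by (auto simp: continuous_functional_def)
    then obtain M where M: "\<And>i v. v \<in> Y \<Longrightarrow> \<bar>h i v\<bar> \<le> M i * ?n v" by metis
    have nn: "0 \<le> ?n v" if "v \<in> Y" for v
      using npos[OF that] n0 by (cases "v = 0") auto
    have "norm (C v) \<le> (\<Sum>i\<in>UNIV. \<bar>M i\<bar>) * ?n v" if v: "v \<in> Y" for v
    proof -
      have "norm (C v) \<le> (\<Sum>i\<in>UNIV. \<bar>C v $ i\<bar>)" by (rule norm_le_l1_cart)
      also have "\<dots> \<le> (\<Sum>i\<in>UNIV. \<bar>M i\<bar> * ?n v)"
      proof (rule sum_mono)
        fix i
        have "\<bar>C v $ i\<bar> \<le> M i * ?n v" using M[OF v] assms(23) v by simp
        also have "\<dots> \<le> \<bar>M i\<bar> * ?n v" using nn[OF v] by (intro mult_right_mono) auto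
        finally show "\<bar>C v $ i\<bar> \<le> \<bar>M i\<bar> * ?n v" .
      qed
      finally show ?thesis by (simp add: sum_distrib_right)
    qed
    then show ?thesis using that[of "\<Sum>i\<in>UNIV. \<bar>M i\<bar>"] by (simp add: sum_nonneg)
  qed
  have cf_C: "continuous_functional Y ?n (\<lambda>v. ipD z (C v))" for z
  proof -
    have "\<bar>ipD z (C v)\<bar> \<le> (B * norm z * M) * ?n v" if "v \<in> Y" for v
      using B(2)[of z "C v"] mult_left_mono[OF M(2)[OF that], of "B * norm z"] B(1)
      by (simp add: mult.assoc)
    moreover have "linear_on Y (\<lambda>v. ipD z (C v))"
    proof -
      have "ipD z (x + y) = ipD z x + ipD z y" "ipD z (c *\<^sub>R x) = c * ipD z x" for x y c
        using ipD_bil by (auto simp: bilinear_on_def linear_on_def)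
      moreover have "C 0 = 0" using C_add[of 0 0 1] subspace_0[OF subY] by simp
      ultimately show ?thesis
        using C_add[of _ _ 1] C_add[of 0] subspace_0[OF subY] by (simp add: linear_on_def)
    qed
    ultimately show ?thesis unfolding continuous_functional_def by blast
  qed
  have C_bound: "ipD (C v) (C v) \<le> \<gamma>c\<^sup>2 * (?n v)\<^sup>2" if "v \<in> Y" for v
  proof -
    \<comment> \<open>\<open>sqrt B * M\<close> is the a priori bound that makes the supremum
      \<open>\<gamma>c\<close> a valid constant.\<close>
    have "ip_norm ipD (C v) \<le> (sqrt B * M) * ?n v" if "v \<in> Y" for v
    proof -
      have "ip_norm ipD (C v) \<le> sqrt (B * (norm (C v))\<^sup>2)"
        unfolding ip_norm_def using B(2)[of "C v" "C v"] by (simp add: power2_eq_square)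
      also have "\<dots> = sqrt B * norm (C v)" by (simp add: real_sqrt_mult)
      also have "\<dots> \<le> sqrt B * (M * ?n v)" using M(2)[OF that] B(1) by (intro mult_left_mono) auto
      finally show ?thesis by simp
    qed
    then have "ip_norm ipD (C v) \<le> \<gamma>c * ?n v"
      unfolding assms(37) using npos n0 that by (rule operator_norm_bound)
    then have "(ip_norm ipD (C v))\<^sup>2 \<le> (\<gamma>c * ?n v)\<^sup>2"
      by (intro power_mono) (auto simp: ip_norm_def inner_product_on_nonneg[OF assms(21)])
    then show ?thesis using ip_norm_square[OF assms(21)] by (simp add: power_mult_distrib)
  qed

  \<comment> \<open>Feasibility and the control error \<open>e\<close>\<close>
  have feas: "feasible \<tau> K ?a b f (l2_on \<Omega>) Y U U (y, u)"
    and feas_N: "feasible \<tau> K ?a b f (l2_on \<Omega>) Y_N U_N0 U_N (y_N, u_N)"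
    using FE_optimal RB_optimal by (auto simp: is_arg_min_def)
  have yY: "y k \<in> Y" "y_N k \<in> Y" "p_N k \<in> Y" if "k \<in> {1..K}" for k
    using feas feas_N RB_adjoint assms(26) that
    by (auto simp: feasible_def adjoint_solution_def)
  have uU: "u k \<in> U" "u_N k \<in> U" if "k \<le> K" for k
    using feas feas_N assms(28,30) that by (cases "k = 0"; auto simp: feasible_def)+
  define e where "e k = u k - u_N k" for k
  have eU: "e k \<in> U" if "k \<le> K" for k
    using uU[OF that] subU by (simp add: e_def subspace_diff)
  have b_e: "b (e k) v = b (u k) v - b (u_N k) v" if "k \<le> K" "v \<in> Y" for k v
    unfolding e_def
    by (rule linear_on_diff[OF bilinear_on_left[OF bbil that(2)] subU uU[OF that(1)]])

  \<comment> \<open>Homogeneous state \<open>s\<close>, stationarity, and remainder \<open>d\<close>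
    of the state error\<close>
  obtain s where s0: "s 0 = e 0" and s: "\<And>k. s (Suc k) \<in> Y \<and> (\<forall>v\<in>Y. s (Suc k) \<bullet> v + \<tau> * ?a (s (Suc k)) v
        = s k \<bullet> v + \<tau> * (if k < K then b (e (Suc k)) v else 0))"
  proof -
    have "\<exists>s. s 0 = e 0 \<and> (\<forall>k. s (Suc k) \<in> Y \<and> (\<forall>v\<in>Y. s (Suc k) \<bullet> v + \<tau> * ?a (s (Suc k)) v
        = s k \<bullet> v + \<tau> * (if k < K then b (e (Suc k)) v else 0)))"
    proof (rule implicit_euler_solvable[OF assms(6) abil less_imp_le[OF \<tau>]])
      show "0 \<le> ?a v v" if "v \<in> Y" for v
        using coercive[OF that] \<alpha> by (meson less_imp_le mult_nonneg_nonneg order_trans zero_le_power2)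
      \<comment> \<open>\<open>e\<close> is known to lie in \<open>U\<close> only up to index
        \<open>K\<close>. Beyond it the source is set to 0, which keeps it linear at every
        step.\<close>
      show "linear_on Y (\<lambda>v. \<tau> * (if k < K then b (e (Suc k)) v else 0))" for k
        using bilinear_on_right[OF bbil eU[of "Suc k"]]
        by (auto simp: linear_on_def algebra_simps)
    qed
    then show ?thesis using that by blast
  qed
  have sY: "s k \<in> Y" if "k \<in> {1..K}" for k
    using s[of "k - 1"] that by simp
  have s_eq: "s k \<bullet> v + \<tau> * ?a (s k) v = s (k - 1) \<bullet> v + \<tau> * b (e k) v" if "k \<in> {1..K}" "v \<in> Y" for k v
  proof -
    have "Suc (k - 1) = k" "k - 1 < K" using that by auto
    then show ?thesis using s[of "k - 1"] that(2) by simp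
  qed
  have stationary: "(u 0 - u_d 0) \<bullet> e 0 + \<tau> * (\<Sum>k=1..K. (u k - u_d k) \<bullet> e k)
       + \<tau> * (\<Sum>k=1..K. ipD (C (y k) - z_d k) (C (s k))) = 0"
    using s0 eU[of 0] assms(9) eU sY s_eq
    by (intro optimal_stationary[OF FE_optimal assms(21) C_add subY subU subU subspace_l2_on abil bbil]) auto

  \<comment> \<open>\<open>y 0 - y_N 0 - s 0\<close> is only orthogonal to \<open>Y\<close>, so it may be replaced by \<open>0\<close>.\<close>
  define d where "d k = (if k = 0 then 0 else y k - y_N k - s k)" for k
  have dY: "d k \<in> Y" if "k \<in> {1..K}" for k
    using yY[OF that] sY[OF that] subY that by (simp add: d_def subspace_diff)
  have d_eq: "(d k - d (k - 1)) \<bullet> v + \<tau> * ?a (d k) v = \<tau> * ?ry k v" if k: "k \<in> {1..K}" and v: "v \<in> Y" for k v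
  proof -
    \<comment> \<open>For \<open>k = 1\<close> the right-hand side is 0: against \<open>Y\<close>,
      the vectors \<open>y 0\<close>, \<open>y_N 0\<close> and \<open>s 0\<close> act as
      \<open>u 0\<close>, \<open>u_N 0\<close> and \<open>e 0\<close>, the second by
      \<open>RB_initial\<close>.\<close>
    have "d (k - 1) \<bullet> v = y (k - 1) \<bullet> v - y_N (k - 1) \<bullet> v - s (k - 1) \<bullet> v"
      using feas RB_initial v s0 by (auto simp: d_def feasible_def e_def inner_diff_left)
    moreover have "d k \<bullet> v = y k \<bullet> v - y_N k \<bullet> v - s k \<bullet> v"
      using k by (simp add: d_def inner_diff_left)
    moreover have "\<tau> * ?a (d k) v = \<tau> * ?a (y k) v - \<tau> * ?a (y_N k) v - \<tau> * ?a (s k) v"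
      using linear_on_diff[OF bilinear_on_left[OF abil v] subY] yY[OF k] sY[OF k] subY k
      by (simp add: d_def subspace_diff right_diff_distrib)
    moreover have "y k \<bullet> v + \<tau> * ?a (y k) v = y (k - 1) \<bullet> v + \<tau> * b (u k) v + \<tau> * f v"
      using feas k v by (simp add: feasible_def)
    moreover have "\<tau> * ?ry k v
        = \<tau> * f v + \<tau> * b (u_N k) v - \<tau> * ?a (y_N k) v - (y_N k - y_N (k - 1)) \<bullet> v"
      using \<tau> by (simp add: res_y_def algebra_simps)
    moreover have "\<tau> * b (e k) v = \<tau> * b (u k) v - \<tau> * b (u_N k) v"
      using b_e[of k v] k v by (simp add: right_diff_distrib)
    ultimately show ?thesis
      using s_eq[OF k v] unfolding inner_diff_left by linarith
  qed

  \<comment> \<open>Discrete space-time norms of the errors\<close>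
  define E where "E = sqrt ((norm (e 0))\<^sup>2 + \<tau> * (\<Sum>k=1..K. (norm (e k))\<^sup>2))"
  define Eb where "Eb = sqrt (\<tau> * (\<Sum>k=1..K. (norm (e k))\<^sup>2))"
  define S where "S = sqrt (\<tau> * (\<Sum>k=1..K. (?n (s k))\<^sup>2))"
  define D where "D = sqrt (\<tau> * (\<Sum>k=1..K. (?n (d k))\<^sup>2))"
  have nonneg: "0 \<le> \<tau> * (\<Sum>k=1..K. (x k)\<^sup>2)" for x :: "nat \<Rightarrow> real"
    using \<tau> by (simp add: sum_nonneg)
  have squares: "Eb\<^sup>2 = \<tau> * (\<Sum>k=1..K. (norm (e k))\<^sup>2)" "E\<^sup>2 = (norm (e 0))\<^sup>2 + Eb\<^sup>2"
      "S\<^sup>2 = \<tau> * (\<Sum>k=1..K. (?n (s k))\<^sup>2)" "D\<^sup>2 = \<tau> * (\<Sum>k=1..K. (?n (d k))\<^sup>2)"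
    unfolding E_def Eb_def S_def D_def using nonneg by simp_all
  have E0: "0 \<le> E" "0 \<le> Eb" "0 \<le> S" "0 \<le> D" and R0: "0 \<le> Ry" "0 \<le> Rp"
    unfolding E_def Eb_def S_def D_def assms(38,39) time_dual_norm_def using nonneg by simp_all

  \<comment> \<open>Identity for the squared control error\<close>
  have identity: "E\<^sup>2 = ?r0 (e 0) + \<tau> * (\<Sum>k=1..K. ?ru k (e k)) + \<tau> * (\<Sum>k=1..K. ?rp k (s k))
      + \<tau> * (\<Sum>k=1..K. - ipD (C (s k + d k)) (C (s k)))"
  proof -
    \<comment> \<open>\<open>?g k\<close> holds the parts at time \<open>k\<close> of the
      stationarity condition and of the claimed right-hand side. What is left over consists of time
      differences paired with \<open>s\<close> and \<open>p_N\<close>.\<close>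
    let ?g = "\<lambda>k. \<tau> * ((u k - u_d k) \<bullet> e k) + \<tau> * ipD (C (y k) - z_d k) (C (s k))
        + \<tau> * ?ru k (e k) + \<tau> * ?rp k (s k) + \<tau> * - ipD (C (s k + d k)) (C (s k))"
    have "\<tau> * (norm (e k))\<^sup>2 = ?g k + (s k \<bullet> (p_N k - p_N (k + 1)) - (s k - s (k - 1)) \<bullet> p_N k)"
      if k: "k \<in> {1..K}" for k
    proof -
      have "(norm (e k))\<^sup>2 = (u k - u_d k) \<bullet> e k + ?ru k (e k) - b (e k) (p_N k)"
        by (simp add: res_u_def e_def power2_norm_eq_inner inner_diff_left inner_diff_right)
      then have 1: "\<tau> * (norm (e k))\<^sup>2
          = \<tau> * ((u k - u_d k) \<bullet> e k) + \<tau> * ?ru k (e k) - \<tau> * b (e k) (p_N k)"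
        by (simp only: distrib_left right_diff_distrib)
      have 2: "\<tau> * ?rp k (s k) = \<tau> * ipD (z_d k - C (y_N k)) (C (s k)) - \<tau> * ?a (s k) (p_N k)
          - s k \<bullet> (p_N k - p_N (k + 1))"
        using \<tau> by (simp add: res_p_def algebra_simps)
      have "s k + d k = y k + (-1) *\<^sub>R y_N k" using k by (simp add: d_def)
      then have C_eq: "C (s k + d k) = (C (y k) - z_d k) + (z_d k - C (y_N k))"
        using C_add[OF yY(1,2)[OF k], of "-1"] by simp
      have "ipD (C (s k + d k)) (C (s k))
          = ipD (C (y k) - z_d k) (C (s k)) + ipD (z_d k - C (y_N k)) (C (s k))"
        unfolding C_eq using linear_on_add[OF bilinear_on_left[OF ipD_bil UNIV_I] UNIV_I UNIV_I] .
      then have 3: "\<tau> * ipD (C (s k + d k)) (C (s k))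
          = \<tau> * ipD (C (y k) - z_d k) (C (s k)) + \<tau> * ipD (z_d k - C (y_N k)) (C (s k))"
        by (simp add: distrib_left)
      \<comment> \<open>Testing the equation of \<open>s\<close> with \<open>p_N k\<close> trades
        \<open>b (e k) (p_N k)\<close> for \<open>?a (s k) (p_N k)\<close>, which cancels against
        the adjoint residual.\<close>
      show ?thesis
        using 1 2 3 s_eq[OF k yY(3)[OF k]] unfolding inner_diff_left[of "s k"] by linarith
    qed
    then have "Eb\<^sup>2 = (\<Sum>k=1..K. ?g k)
        + ((\<Sum>k=1..K. s k \<bullet> (p_N k - p_N (k + 1))) - (\<Sum>k=1..K. (s k - s (k - 1)) \<bullet> p_N k))"
      unfolding squares(1) sum_distrib_left by (simp add: sum.distrib sum_subtractf)
    \<comment> \<open>As \<open>p_N (K + 1) = 0\<close>, only the initial boundary term remains; it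
      cancels against the one coming from \<open>?r0\<close> below.\<close>
    also have "\<dots> = (\<Sum>k=1..K. ?g k) + e 0 \<bullet> p_N 1"
      using RB_adjoint unfolding summation_by_parts s0 by (simp add: adjoint_solution_def)
    finally have Eb: "Eb\<^sup>2 = (\<Sum>k=1..K. ?g k) + e 0 \<bullet> p_N 1" .
    have "(norm (e 0))\<^sup>2 = (u 0 - u_d 0) \<bullet> e 0 + ?r0 (e 0) - e 0 \<bullet> p_N 1"
      by (simp add: res_u0_def e_def power2_norm_eq_inner inner_diff_left inner_diff_right)
    then show ?thesis
      using Eb stationary unfolding squares(2) sum_distrib_left sum.distrib by linarith
  qed

  \<comment> \<open>Continuity of the residuals\<close>
  have cf_ru: "continuous_functional U norm (?ru k)" if "k \<in> {1..K}" for k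
    unfolding res_u_def using yY[OF that]
    by (intro continuous_functional_diff continuous_form_left[OF assms(14)]
        continuous_functional_inner[of _ 1]) auto
  have cf_r0: "continuous_functional U norm ?r0"
    unfolding res_u0_def inner_commute[of _ "p_N 1"]
    by (intro continuous_functional_diff continuous_functional_inner[of _ 1]) auto
  have cf_ry: "continuous_functional Y ?n (?ry k)" if "k \<in> {1..K}" for k
    unfolding res_y_def using yY[OF that] uU[of k] that
    by (intro continuous_functional_diff continuous_functional_add continuous_functional_cmult
        continuous_form_right[OF assms(14)] continuous_form_right[OF acf] assms(20) cf_inner) auto
  have cf_rp: "continuous_functional Y ?n (?rp k)" if "k \<in> {1..K}" for k
    unfolding res_p_def inner_commute[of _ "p_N k - p_N (k + 1)"] using yY[OF that]
    by (intro continuous_functional_diff continuous_functional_cmult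
        continuous_form_left[OF acf] cf_C cf_inner) auto

  \<comment> \<open>Contribution of the control residuals\<close>
  have "?r0 (e 0) + \<tau> * (\<Sum>k=1..K. ?ru k (e k)) \<le> r0 * norm (e 0) + Ru * Eb"
    unfolding assms(40,41) Eb_def using cf_ru cf_r0 eU \<tau>
    by (intro add_mono dual_norm_bound time_dual_norm_bound) auto
  also have "\<dots> \<le> sqrt (r0\<^sup>2 + Ru\<^sup>2) * E"
    using real_Cauchy_Schwarz_2[of r0 "norm (e 0)" Ru Eb] E0 unfolding squares(2)[symmetric] by simp
  finally have control: "?r0 (e 0) + \<tau> * (\<Sum>k=1..K. ?ru k (e k)) \<le> sqrt (r0\<^sup>2 + Ru\<^sup>2) * E" .

  \<comment> \<open>Adjoint residuals and the energy estimate for \<open>s\<close>\<close>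
  have adjoint: "\<tau> * (\<Sum>k=1..K. ?rp k (s k)) \<le> Rp * (sqrt (2 * \<gamma>b\<^sup>2 / ?\<alpha>\<^sup>2 + 1 / ?\<alpha>) * E)"
  proof -
    have \<gamma>b: "b w v \<le> \<gamma>b * norm w * ?n v" if "w \<in> U" "v \<in> Y" for w v
      unfolding assms(36) using that npos n0 by (intro form_norm_bound[OF assms(14)]) auto
    have \<gamma>b0: "0 \<le> \<gamma>b"
      unfolding assms(36) using npos n0 subspace_0[OF subY] subspace_0[OF subU]
      by (intro form_norm_bound[OF assms(14)]) auto
    have "?\<alpha> * S\<^sup>2 \<le> (norm (s 0))\<^sup>2 / 2 + \<tau> * (\<Sum>k=1..K. b (e k) (s k))"
      unfolding squares(3) using \<tau> s_eq sY coercive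
      by (intro implicit_euler_energy[where a = ?a]) (auto simp: inner_diff_left algebra_simps)
    also have "\<tau> * (\<Sum>k=1..K. b (e k) (s k)) \<le> \<tau> * (\<Sum>k=1..K. \<gamma>b * norm (e k) * ?n (s k))"
      using \<tau> \<gamma>b eU sY by (intro mult_left_mono sum_mono) auto
    also have "\<dots> = \<gamma>b * (\<tau> * (\<Sum>k=1..K. norm (e k) * ?n (s k)))"
      by (simp add: sum_distrib_left ac_simps)
    also have "\<dots> \<le> \<gamma>b * (Eb * S)"
      unfolding Eb_def S_def using \<gamma>b0 \<tau> by (intro mult_left_mono weighted_Cauchy_Schwarz) auto
    finally have energy: "?\<alpha> * S\<^sup>2 \<le> (norm (e 0))\<^sup>2 / 2 + \<gamma>b * (Eb * S)" by (simp add: s0)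
    \<comment> \<open>Young's inequality, weighted so that it absorbs half of the left-hand side
      once the energy estimate is multiplied by \<open>2 * ?\<alpha>\<close>.\<close>
    have "0 \<le> (\<gamma>b * Eb - ?\<alpha> * S)\<^sup>2" by simp
    then have "2 * ?\<alpha> * (\<gamma>b * (Eb * S)) \<le> \<gamma>b\<^sup>2 * Eb\<^sup>2 + ?\<alpha>\<^sup>2 * S\<^sup>2"
      by (simp add: power2_diff power_mult_distrib algebra_simps)
    moreover have "2 * ?\<alpha> * (?\<alpha> * S\<^sup>2) \<le> 2 * ?\<alpha> * ((norm (e 0))\<^sup>2 / 2 + \<gamma>b * (Eb * S))"
      using energy \<alpha> by (intro mult_left_mono) auto
    ultimately have "?\<alpha>\<^sup>2 * S\<^sup>2 \<le> ?\<alpha> * (norm (e 0))\<^sup>2 + \<gamma>b\<^sup>2 * Eb\<^sup>2"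
      by (simp add: power2_eq_square algebra_simps)
    \<comment> \<open>The squares of \<open>norm (e 0)\<close> and \<open>Eb\<close> are each at
      most the square of \<open>E\<close>; the factor 2 is the one in \<open>c1\<close>.\<close>
    also have "\<dots> \<le> ?\<alpha> * E\<^sup>2 + 2 * \<gamma>b\<^sup>2 * E\<^sup>2"
    proof (intro add_mono mult_left_mono)
      have "\<gamma>b\<^sup>2 * Eb\<^sup>2 \<le> \<gamma>b\<^sup>2 * E\<^sup>2" unfolding squares(2) by (intro mult_left_mono) auto
      then show "\<gamma>b\<^sup>2 * Eb\<^sup>2 \<le> 2 * \<gamma>b\<^sup>2 * E\<^sup>2"
        using mult_nonneg_nonneg[OF zero_le_power2[of \<gamma>b] zero_le_power2[of E]] by linarith
    qed (use \<alpha> squares(2) in auto)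
    finally have "S\<^sup>2 \<le> (2 * \<gamma>b\<^sup>2 / ?\<alpha>\<^sup>2 + 1 / ?\<alpha>) * E\<^sup>2"
      using \<alpha> by (simp add: field_simps power2_eq_square)
    then have "S \<le> sqrt ((2 * \<gamma>b\<^sup>2 / ?\<alpha>\<^sup>2 + 1 / ?\<alpha>) * E\<^sup>2)"
      by (rule real_le_rsqrt)
    also have "\<dots> = sqrt (2 * \<gamma>b\<^sup>2 / ?\<alpha>\<^sup>2 + 1 / ?\<alpha>) * E"
      using E0 by (simp add: real_sqrt_mult)
    finally have "Rp * S \<le> Rp * (sqrt (2 * \<gamma>b\<^sup>2 / ?\<alpha>\<^sup>2 + 1 / ?\<alpha>) * E)"
      using R0(2) by (rule mult_left_mono)
    moreover have "\<tau> * (\<Sum>k=1..K. ?rp k (s k)) \<le> Rp * S"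
      unfolding assms(39) S_def using cf_rp npos n0 sY \<tau> by (intro time_dual_norm_bound) auto
    ultimately show ?thesis by simp
  qed

  \<comment> \<open>Observation term and the energy estimate for \<open>d\<close>\<close>
  have state: "\<tau> * (\<Sum>k=1..K. - ipD (C (s k + d k)) (C (s k))) \<le> c2"
  proof -
    have "?\<alpha> * D\<^sup>2 \<le> (norm (d 0))\<^sup>2 / 2 + \<tau> * (\<Sum>k=1..K. ?ry k (d k))"
      unfolding squares(4) using \<tau> d_eq dY coercive
      by (intro implicit_euler_energy[where a = ?a]) auto
    also have "\<tau> * (\<Sum>k=1..K. ?ry k (d k)) \<le> Ry * D"
      unfolding assms(38) D_def using cf_ry npos n0 dY \<tau> by (intro time_dual_norm_bound) auto
    \<comment> \<open>The choice \<open>d 0 = 0\<close> removes the initial norm. One factor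
      \<open>D\<close> is then cancelled, with \<open>D = 0\<close> treated apart.\<close>
    finally have "(?\<alpha> * D) * D \<le> Ry * D" by (simp add: d_def power2_eq_square mult.assoc)
    then have "?\<alpha> * D \<le> Ry"
      using E0(4) R0(1) by (cases "D = 0") (auto simp: mult_le_cancel_right)
    then have "D \<le> Ry / ?\<alpha>" using \<alpha> by (simp add: field_simps)
    then have D: "D\<^sup>2 \<le> (Ry / ?\<alpha>)\<^sup>2" using E0(4) by (rule power_mono)
    \<comment> \<open>Completing the square eliminates \<open>s k\<close>, so the energy bound for
      \<open>d\<close> suffices.\<close>
    have "- ipD (C (s k + d k)) (C (s k)) \<le> \<gamma>c\<^sup>2 / 4 * (?n (d k))\<^sup>2" if "k \<in> {1..K}" for k
      using neg_inner_product_le[OF assms(21) subspace_UNIV UNIV_I UNIV_I, of "C (s k)" "C (d k)"]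
        C_add[OF sY dY, OF that that, of 1] C_bound[OF dY[OF that]] by simp
    then have "\<tau> * (\<Sum>k=1..K. - ipD (C (s k + d k)) (C (s k)))
        \<le> \<tau> * (\<Sum>k=1..K. \<gamma>c\<^sup>2 / 4 * (?n (d k))\<^sup>2)"
      using \<tau> by (intro mult_left_mono sum_mono) auto
    also have "\<dots> = \<gamma>c\<^sup>2 / 4 * D\<^sup>2"
      unfolding squares(4) by (simp add: sum_distrib_left ac_simps)
    \<comment> \<open>The factor 1/4 is enlarged to the 1/2 occurring in \<open>c2\<close>.\<close>
    also have "\<dots> \<le> \<gamma>c\<^sup>2 / 2 * (Ry / ?\<alpha>)\<^sup>2"
      using D by (intro mult_mono) auto
    also have "\<dots> = \<gamma>c\<^sup>2 / (2 * ?\<alpha>\<^sup>2) * Ry\<^sup>2"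
      by (simp add: power_divide)
    \<comment> \<open>The mixed term of \<open>c2\<close> is nonnegative, so adding it preserves the
      inequality.\<close>
    also have "\<dots> \<le> c2"
      unfolding assms(43) using \<alpha> R0 by simp
    finally show ?thesis .
  qed

  \<comment> \<open>Solving the quadratic inequality for the control error\<close>
  have "E\<^sup>2 \<le> 2 * c1 * E + c2"
    using identity control adjoint state unfolding assms(42) by (simp add: algebra_simps)
  then show ?thesis
    using quadratic_root_bound unfolding E_def e_def by blast
qed

end
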